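(* Let $G$ be a group, $M$ a right $\mathbb Z[G]$-module, $\varphi:G\to Z(G)$ a group homomorphism into the center of $G$, $X=\bigsqcup_{m\in M}(\{m\}\times G)=M\times G$ the $G$-Alexander multiple conjugation biquandle of $(M,\varphi)$, regarded also as an $X$-set with action $*:=\underline{*}$, $A$ an abelian group (the coefficient group) and $\lambda:G\to A$ a group homomorphism. Below, $m_i':=m_i-m_{i+1}$. (1) Let $f:M^3\to A$ be a $G$-invariant $A$-multilinear map. The $2$-cocycle $\Phi_{f,\lambda}=(f\otimes{\rm id}_A)\circ\psi_{2,\lambda}\circ\gamma_2\circ{\rm proj}_2:C_2(X;\mathbb Z)_X\to A$ of the $G$-Alexander multiple conjugation biquandle $X$ is formulated as $$\Phi_{f,\lambda}(\langle(m_0,g_0)\rangle\langle(m_1,g_1)\rangle\langle(m_2,g_2)\rangle)=f\bigl(m_0'(1-\varphi(g_1)^{-1}g_1),\;m_1',\;m_2(1-\varphi(g_2)g_2^{-1})\bigr)\otimes\lambda(g_0)$$ for any $\langle(m_0,g_0)\rangle\langle(m_1,g_1)\rangle\langle(m_2,g_2)\rangle\in X\times X^2$. (2) Let $f:M^4\to A$ be a $G$-invariant $A$-multilinear map. The $3$-cocycle $\Phi_{f,\lambda}=(f\otimes{\rm id}_A)\circ\psi_{3,\lambda}\circ\gamma_3\circ{\rm proj}_3:C_3(X;\mathbb Z)_X\to A$ of the $G$-Alexander multiple conjugation biquandle $X$ is formulated as $$\begin{aligned}\Phi_{f,\lambda}(\langle(m_0,g_0)\rangle\langle(m_1,g_1)\rangle\langle(m_2,g_2)\rangle\langle(m_3,g_3)\rangle)=\;&f\bigl(m_0'(1-\varphi(g_1)^{-1}g_1),\,m_1',\,m_2',\,m_3(1-\varphi(g_3)g_3^{-1})\bigr)\otimes\lambda(g_0)\\&-f\bigl(m_0'(1-\varphi(g_1)^{-1}g_1)g_2,\,m_1'g_2,\,m_2'\varphi(g_2),\,m_3(1-\varphi(g_3)g_3^{-1})\varphi(g_2)\bigr)\otimes\lambda(g_0)\end{aligned}$$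 for any $\langle(m_0,g_0)\rangle\langle(m_1,g_1)\rangle\langle(m_2,g_2)\rangle\langle(m_3,g_3)\rangle\in X\times X^3$.
   Context: **$G$-Alexander multiple conjugation biquandle (MCB).** $X=M\times G$ with $(m,g)\,\underline{*}\,(n,h)=(mh+n(\varphi(h)-h),\,h^{-1}gh)$, $(m,g)\,\overline{*}\,(n,h)=(m\varphi(h),\,g)$, decomposed as the disjoint union of the groups $G_m:=\{m\}\times G$ ($m\in M$) with product $(m,g)(m,h)=(m,gh)$. **$G$-invariant $A$-multilinear maps.** "$A$-multilinear map $f:M^n\to A$" is the source's term for a multilinear map with values in the coefficient group $A$; the source gives no further definition. In particular $f$ is additive in each variable. It is $G$-invariant if $f(m_1g,\dots,m_ng)=f(m_1,\dots,m_n)$ for all $g\in G$ and $(m_1,\dots,m_n)\in M^n$. Such an $f$ induces a group cocycle $f:C_n^{\rm gp}(M;\mathbb Z)_G\to A$, where $C_n^{\rm gp}(M;\mathbb Z)_G$ is the free abelian group on $M^n$ modulo all $(m_1g,\dots,m_ng)-(m_1,\dots,m_n)$. **MCB complex with the $X$-set $X$.** For $n\ge0$, $P_n(X;\mathbb Z)_X$ is the free abelian group on symbols $\langle x_0\rangle\langle\bm x_1\rangle\cdots\langle\bm x_k\rangle$, where $x_0\in X$, $\langle\bm x_i\rangle=\langle x_{i1},\dots,x_{in_i}\rangle$ with $n_i\ge1$, all entries of a given $\bm x_i$ ($i\ge1$) lie in one and the same group $G_m$ ($m$ may depend on $i$), and $n_1+\cdots+n_k=n$. Operations with an element apply entrywise.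 For $n\ge1$, $$\partial_n(\langle x_0\rangle\langle\bm x_1\rangle\cdots\langle\bm x_k\rangle)=\sum_{i=1}^k(-1)^{n_1+\cdots+n_{i-1}}\Bigl\{\langle x_0\underline{*}x_{i1}\rangle\langle\bm x_1\underline{*}x_{i1}\rangle\cdots\langle\bm x_{i-1}\underline{*}x_{i1}\rangle\langle\widetilde{\bm x}_i\overline{*}x_{i1}\rangle\langle\bm x_{i+1}\overline{*}x_{i1}\rangle\cdots\langle\bm x_k\overline{*}x_{i1}\rangle+\sum_{j=1}^{n_i}(-1)^j\langle x_0\rangle\langle\bm x_1\rangle\cdots\langle x_{i1},\dots,x_{i(j-1)},x_{i(j+1)},\dots,x_{in_i}\rangle\cdots\langle\bm x_k\rangle\Bigr\},$$ with $\langle\widetilde{\bm x}_i\overline{*}x_{i1}\rangle=\langle(x_{i1}^{-1}x_{i2})\overline{*}x_{i1},\dots,(x_{i1}^{-1}x_{in_i})\overline{*}x_{i1}\rangle$; factors that become empty are omitted. For $\langle\bm a\rangle=\langle a_1,\dots,a_s\rangle$, $\langle\bm b\rangle=\langle b_1,\dots,b_t\rangle$ with all entries in one group $G_m$, put $$\langle\langle\bm a\rangle\langle\bm b\rangle\rangle=\sum_\mu(-1)^{\sum_{l=1}^s(\mu(l)-l)}\langle c_1,\dots,c_{s+t}\rangle,\qquad c_j=a_{\lfloor j;\mu\rfloor}\,b_{j-\lfloor j;\mu\rfloor},$$ over strictly increasing $\mu:\{1,\dots,s\}\to\{1,\dots,s+t\}$, where $\lfloor j;\mu\rfloor$ is the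 number of $l$ with $\mu(l)\le j$ and $a_0=b_0$ is the identity of $G_m$. $D_n(X;\mathbb Z)_X\subset P_n(X;\mathbb Z)_X$ is generated by all $\langle x_0\rangle\langle\bm a_1\rangle\cdots\langle\bm a\rangle\langle\bm b\rangle\cdots\langle\bm a_k\rangle-\langle x_0\rangle\langle\bm a_1\rangle\cdots\langle\langle\bm a\rangle\langle\bm b\rangle\rangle\cdots\langle\bm a_k\rangle$ (with $\bm a,\bm b$ having all entries in one $G_m$) for $n\ge2$, and $D_n=0$ for $n\le1$. It is known that $D_*$ is a subcomplex of the chain complex $P_*$; $C_*(X;\mathbb Z)_X=P_*/D_*$. An $n$-cocycle with coefficients in $A$ is a homomorphism $\Phi:C_n(X;\mathbb Z)_X\to A$ with $\Phi\circ\partial_{n+1}=0$. **The maps ($n\ge2$).** $C_n^{\rm BR}(X;\mathbb Z)_X$ is the free abelian group on $X\times X^n$, and $C_n^{\rm BR_U}(X;\mathbb Z)_X$ is the free abelian group on $G^{n+1}\times M^{n+1}$. - ${\rm proj}_n:P_n(X;\mathbb Z)_X\to C_n^{\rm BR}(X;\mathbb Z)_X$ sends $\langle x_0\rangle\langle\bm x_1\rangle\cdots\langle\bm x_k\rangle$ to $(x_0,x_{11},\dots,x_{k1})$ if $k=n$ and to $0$ otherwise. - $\gamma_n((m_0,g_0),\dots,(m_n,g_n))=(g_0,\dots,g_n;\,m_0-m_1,\dots,m_{n-1}-m_n,\,m_n)$. - $\psi_n(g_0,\dots,g_n;m_0,\dots,m_n)=\sum_{k\in\{0,1\}^n}(-1)^{k_1+\cdots+k_n}(m_0\bm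 g_{k,0},\dots,m_n\bm g_{k,n})\in C_{n+1}^{\rm gp}(M;\mathbb Z)_G$, where $\bm g_{k,0}=g_1^{k_1}\cdots g_n^{k_n}$ and $\bm g_{k,i}=\varphi(g_1^{k_1}\cdots g_i^{k_i})g_{i+1}^{k_{i+1}}\cdots g_n^{k_n}$ for $1\le i\le n$. - $\psi_{n,\lambda}(g_0,\dots,g_n;\bm m)=\psi_n(g_0,\dots,g_n;\bm m)\otimes\lambda(g_0)\in C_{n+1}^{\rm gp}(M;\mathbb Z)_G\otimes A$. - $f\otimes{\rm id}_A$ sends $c\otimes a$ to $f(c)\otimes a$. The source writes the target of the resulting composite as $A$, i.e. it treats $f(c)\otimes a$ as an element of $A$, without spelling out the identification. The composite $(f\otimes{\rm id}_A)\circ\psi_{n,\lambda}\circ\gamma_n\circ{\rm proj}_n$ is formed on $P_n(X;\mathbb Z)_X$ and then regarded on the quotient $C_n(X;\mathbb Z)_X$. *)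

theory Defs
  imports Complex_Main "HOL-Algebra.Free_Abelian_Groups"
begin

text \<open>
  Conventions. The group \<open>G\<close> is an arbitrary, not necessarily commutative, type of class
  \<open>group_add\<close>, so its product, unit and inverse are written \<open>g + h\<close>, \<open>0\<close>, \<open>- g\<close>; for instance
  \<open>- h + g + h\<close> is the conjugate of \<open>g\<close> by \<open>h\<close>. The group ring of \<open>G\<close> over the integers is then
  the ring \<open>'g \<Rightarrow>\<^sub>0 int\<close> of \<open>HOL-Library.Poly_Mapping\<close>, whose multiplication is convolution, and
  \<open>frag_of g\<close> is the group element \<open>g\<close> seen in the group ring.
  Chain groups, their quotients and tensor products are groups in the sense of \<open>HOL-Algebra\<close>,
  in which abelian groups are written multiplicatively.
\<close>

section \<open>Abelian groups\<close>

locale right_module =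
  fixes scale :: "'m::ab_group_add \<Rightarrow> 'r::ring_1 \<Rightarrow> 'm"  (infixl \<open>\<cdot>\<close> 75)
  assumes scale_add_left: "(x + y) \<cdot> r = x \<cdot> r + y \<cdot> r"
    and scale_add_right: "x \<cdot> (r + s) = x \<cdot> r + x \<cdot> s"
    and scale_mult: "x \<cdot> (r * s) = x \<cdot> r \<cdot> s"
    and scale_one: "x \<cdot> 1 = x"

definition additive_group :: "'a::ab_group_add monoid"
  where "additive_group = \<lparr>carrier = UNIV, mult = (+), one = 0\<rparr>"

text \<open>The homomorphism from a free abelian group to \<open>H\<close> with prescribed values on the basis.\<close>

definition free_lift :: "('b, 'k) monoid_scheme \<Rightarrow> ('s \<Rightarrow> 'b) \<Rightarrow> ('s \<Rightarrow>\<^sub>0 int) \<Rightarrow> 'b"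
  where "free_lift H h c =
    finprod H (\<lambda>s. h s [^]\<^bsub>H\<^esub> Poly_Mapping.lookup c s) (Poly_Mapping.keys c)"

text \<open>The map induced on a quotient group by a map \<open>h\<close>, meaningful when \<open>h\<close> is constant on cosets.\<close>

definition quotient_lift :: "('s \<Rightarrow> 'b) \<Rightarrow> 's set \<Rightarrow> 'b"
  where "quotient_lift h X = the_elem (h ` X)"

definition tensor_relations ::
    "('a, 'k) monoid_scheme \<Rightarrow> ('b, 'l) monoid_scheme \<Rightarrow> ('a \<times> 'b \<Rightarrow>\<^sub>0 int) set"
  where "tensor_relations G H =
      {frag_of (x \<otimes>\<^bsub>G\<^esub> x', y) - frag_of (x, y) - frag_of (x', y) | x x' y.
         x \<in> carrier G \<and> x' \<in> carrier G \<and> y \<in> carrier H}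
    \<union> {frag_of (x, y \<otimes>\<^bsub>H\<^esub> y') - frag_of (x, y) - frag_of (x, y') | x y y'.
         x \<in> carrier G \<and> y \<in> carrier H \<and> y' \<in> carrier H}"

definition tensor_subgroup ::
    "('a, 'k) monoid_scheme \<Rightarrow> ('b, 'l) monoid_scheme \<Rightarrow> ('a \<times> 'b \<Rightarrow>\<^sub>0 int) set"
  where "tensor_subgroup G H =
    generate (free_Abelian_group (carrier G \<times> carrier H)) (tensor_relations G H)"

definition tensor_group ::
    "('a, 'k) monoid_scheme \<Rightarrow> ('b, 'l) monoid_scheme \<Rightarrow> ('a \<times> 'b \<Rightarrow>\<^sub>0 int) set monoid"
  where "tensor_group G H =
    free_Abelian_group (carrier G \<times> carrier H) Mod tensor_subgroup G H"

definition pure_tensor ::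
    "('a, 'k) monoid_scheme \<Rightarrow> ('b, 'l) monoid_scheme \<Rightarrow> 'a \<Rightarrow> 'b \<Rightarrow> ('a \<times> 'b \<Rightarrow>\<^sub>0 int) set"
  where "pure_tensor G H x y =
    tensor_subgroup G H #>\<^bsub>free_Abelian_group (carrier G \<times> carrier H)\<^esub> frag_of (x, y)"


section \<open>The G-Alexander multiple conjugation biquandle\<close>

text \<open>The first two operations depend on the right action \<open>act\<close> of the group ring on \<open>M\<close> and on
  the homomorphism \<open>\<phi>\<close>.\<close>

definition under_op ::
    "('m::ab_group_add \<Rightarrow> ('g::group_add \<Rightarrow>\<^sub>0 int) \<Rightarrow> 'm) \<Rightarrow> ('g \<Rightarrow> 'g) \<Rightarrow> 'm \<times> 'g \<Rightarrow> 'm \<times> 'g \<Rightarrow> 'm \<times> 'g"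
  where "under_op act \<phi> = (\<lambda>(m, g) (n, h).
    (act m (frag_of h) + act n (frag_of (\<phi> h) - frag_of h), - h + g + h))"

definition over_op ::
    "('m::ab_group_add \<Rightarrow> ('g::group_add \<Rightarrow>\<^sub>0 int) \<Rightarrow> 'm) \<Rightarrow> ('g \<Rightarrow> 'g) \<Rightarrow> 'm \<times> 'g \<Rightarrow> 'm \<times> 'g \<Rightarrow> 'm \<times> 'g"
  where "over_op act \<phi> = (\<lambda>(m, g) (n, h). (act m (frag_of (\<phi> h)), g))"

text \<open>Product and inverse of the groups \<open>{m} \<times> G\<close>; the product is only meant for two elements
  of the same group.\<close>

definition fibre_mult :: "'m \<times> 'g::group_add \<Rightarrow> 'm \<times> 'g \<Rightarrow> 'm \<times> 'g"
  where "fibre_mult x y = (fst x, snd x + snd y)"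

definition fibre_inv :: "'m \<times> 'g::group_add \<Rightarrow> 'm \<times> 'g"
  where "fibre_inv x = (fst x, - snd x)"

definition same_fibre :: "('m \<times> 'g) list \<Rightarrow> bool"
  where "same_fibre xs \<longleftrightarrow> (\<exists>m. \<forall>x\<in>set xs. fst x = m)"


section \<open>The MCB complex with coefficient X-set X\<close>

text \<open>The symbol \<open>\<langle>x\<^sub>0\<rangle>\<langle>\<^bold>x\<^sub>1\<rangle>\<dots>\<langle>\<^bold>x\<^sub>k\<rangle>\<close> is the pair of \<open>x\<^sub>0\<close> and the list of the lists \<open>\<^bold>x\<^sub>i\<close>.\<close>

type_synonym ('m, 'g) mcb_symbol = "('m \<times> 'g) \<times> ('m \<times> 'g) list list"

definition mcb_symbols :: "nat \<Rightarrow> ('m, 'g) mcb_symbol set"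
  where "mcb_symbols n =
    {(x0, bs). (\<forall>b\<in>set bs. b \<noteq> [] \<and> same_fibre b) \<and> sum_list (map length bs) = n}"

definition mcb_P :: "nat \<Rightarrow> (('m, 'g) mcb_symbol \<Rightarrow>\<^sub>0 int) monoid"
  where "mcb_P n = free_Abelian_group (mcb_symbols n)"

text \<open>Blocks are indexed from 0 here. Filtering by \<open>b \<noteq> []\<close> omits factors that become empty.\<close>

definition mcb_boundary_gen ::
    "('m::ab_group_add \<Rightarrow> ('g::group_add \<Rightarrow>\<^sub>0 int) \<Rightarrow> 'm) \<Rightarrow> ('g \<Rightarrow> 'g) \<Rightarrow>
     ('m, 'g) mcb_symbol \<Rightarrow> (('m, 'g) mcb_symbol \<Rightarrow>\<^sub>0 int)"
  where "mcb_boundary_gen act \<phi> = (\<lambda>(x0, bs).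
    \<Sum>i<length bs.
      (let b = bs ! i; y = hd b;
           under = (\<lambda>x. under_op act \<phi> x y); over = (\<lambda>x. over_op act \<phi> x y)
       in frag_cmul ((- 1) ^ sum_list (map length (take i bs)))
           (frag_of (under x0, filter (\<lambda>b. b \<noteq> [])
              (map (map under) (take i bs)
               @ [map (\<lambda>x. over (fibre_mult (fibre_inv y) x)) (tl b)]
               @ map (map over) (drop (Suc i) bs)))
            + (\<Sum>j = 1..length b. frag_cmul ((- 1) ^ j)
                (frag_of (x0, filter (\<lambda>b. b \<noteq> [])
                   (take i bs @ [take (j - 1) b @ drop j b] @ drop (Suc i) bs)))))))"

definition mcb_boundary ::
    "('m::ab_group_add \<Rightarrow> ('g::group_add \<Rightarrow>\<^sub>0 int) \<Rightarrow> 'm) \<Rightarrow> ('g \<Rightarrow> 'g) \<Rightarrow>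
     (('m, 'g) mcb_symbol \<Rightarrow>\<^sub>0 int) \<Rightarrow> (('m, 'g) mcb_symbol \<Rightarrow>\<^sub>0 int)"
  where "mcb_boundary act \<phi> = frag_extend (mcb_boundary_gen act \<phi>)"

definition shuffle_maps :: "nat \<Rightarrow> nat \<Rightarrow> (nat \<Rightarrow> nat) set"
  where "shuffle_maps s t = {\<mu> \<in> {1..s} \<rightarrow>\<^sub>E {1..s + t}. strict_mono_on {1..s} \<mu>}"

text \<open>The entry \<open>a\<^sub>i\<close> of a list, numbered from 1, with \<open>a\<^sub>0\<close> the identity of the group of
  the elements of the list.\<close>

definition entry :: "('m \<times> 'g::group_add) list \<Rightarrow> nat \<Rightarrow> 'm \<times> 'g"
  where "entry a i = (if i = 0 then (fst (hd a), 0) else a ! (i - 1))"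

text \<open>A strictly increasing \<open>\<mu>\<close> with positive values satisfies \<open>\<mu> l \<ge> l\<close>, so the subtractions
  of natural numbers below are exact.\<close>

definition mcb_shuffle ::
    "('m \<times> 'g::group_add) list \<Rightarrow> ('m \<times> 'g) list \<Rightarrow> (('m \<times> 'g) list \<Rightarrow>\<^sub>0 int)"
  where "mcb_shuffle a b =
    (let s = length a; t = length b in
      \<Sum>\<mu>\<in>shuffle_maps s t.
        frag_cmul ((- 1) ^ (\<Sum>l = 1..s. \<mu> l - l))
          (frag_of (map (\<lambda>j. let p = card {l \<in> {1..s}. \<mu> l \<le> j}
                             in fibre_mult (entry a p) (entry b (j - p)))
                        [1..<Suc (s + t)])))"

text \<open>Since \<open>a\<close> and \<open>b\<close> are nonempty in a symbol, there are no generators, hence only the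
  trivial subgroup, in degrees \<open>n \<le> 1\<close>.\<close>

definition mcb_D :: "nat \<Rightarrow> (('m, 'g::group_add) mcb_symbol \<Rightarrow>\<^sub>0 int) set"
  where "mcb_D n = generate (mcb_P n)
    {frag_of (x0, us @ [a, b] @ vs)
       - frag_extend (\<lambda>c. frag_of (x0, us @ [c] @ vs)) (mcb_shuffle a b) | x0 us a b vs.
       (x0, us @ [a, b] @ vs) \<in> mcb_symbols n \<and> same_fibre (a @ b)}"

definition mcb_C :: "nat \<Rightarrow> (('m, 'g::group_add) mcb_symbol \<Rightarrow>\<^sub>0 int) set monoid"
  where "mcb_C n = mcb_P n Mod mcb_D n"

definition mcb_class ::
    "nat \<Rightarrow> (('m, 'g::group_add) mcb_symbol \<Rightarrow>\<^sub>0 int) \<Rightarrow> (('m, 'g) mcb_symbol \<Rightarrow>\<^sub>0 int) set"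
  where "mcb_class n c = mcb_D n #>\<^bsub>mcb_P n\<^esub> c"

text \<open>The subgroups \<open>mcb_D n\<close> form a subcomplex, and the boundary in the quotient complex of the class
  of a chain \<open>c\<close> is the class of the boundary of \<open>c\<close>.\<close>

definition mcb_cocycle ::
    "('m::ab_group_add \<Rightarrow> ('g::group_add \<Rightarrow>\<^sub>0 int) \<Rightarrow> 'm) \<Rightarrow> ('g \<Rightarrow> 'g) \<Rightarrow>
     ('b, 'k) monoid_scheme \<Rightarrow> nat \<Rightarrow> ((('m, 'g) mcb_symbol \<Rightarrow>\<^sub>0 int) set \<Rightarrow> 'b) \<Rightarrow> bool"
  where "mcb_cocycle act \<phi> B n F \<longleftrightarrow>
    F \<in> hom (mcb_C n) B \<and>
    (\<forall>c\<in>carrier (mcb_P (Suc n)). F (mcb_class n (mcb_boundary act \<phi> c)) = \<one>\<^bsub>B\<^esub>)"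


section \<open>Group chains and multilinear maps\<close>

text \<open>An element of \<open>M\<^sup>n\<close> is a list of length \<open>n\<close>.\<close>

definition multilinear :: "nat \<Rightarrow> ('m::ab_group_add list \<Rightarrow> 'a::ab_group_add) \<Rightarrow> bool"
  where "multilinear n f \<longleftrightarrow>
    (\<forall>ms i. length ms = n \<longrightarrow> i < n \<longrightarrow> Modules.additive (\<lambda>x. f (ms[i := x])))"

definition G_invariant ::
    "('m::ab_group_add \<Rightarrow> ('g::group_add \<Rightarrow>\<^sub>0 int) \<Rightarrow> 'm) \<Rightarrow> nat \<Rightarrow> ('m list \<Rightarrow> 'a) \<Rightarrow> bool"
  where "G_invariant act n f \<longleftrightarrow>
    (\<forall>g ms. length ms = n \<longrightarrow> f (map (\<lambda>m. act m (frag_of g)) ms) = f ms)"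

definition gp_subgroup ::
    "('m::ab_group_add \<Rightarrow> ('g::group_add \<Rightarrow>\<^sub>0 int) \<Rightarrow> 'm) \<Rightarrow> nat \<Rightarrow> ('m list \<Rightarrow>\<^sub>0 int) set"
  where "gp_subgroup act n = generate (free_Abelian_group {ms. length ms = n})
    {frag_of (map (\<lambda>m. act m (frag_of g)) ms) - frag_of ms | g ms. length ms = n}"

definition gp_C ::
    "('m::ab_group_add \<Rightarrow> ('g::group_add \<Rightarrow>\<^sub>0 int) \<Rightarrow> 'm) \<Rightarrow> nat \<Rightarrow> ('m list \<Rightarrow>\<^sub>0 int) set monoid"
  where "gp_C act n = free_Abelian_group {ms. length ms = n} Mod gp_subgroup act n"

definition gp_class ::
    "('m::ab_group_add \<Rightarrow> ('g::group_add \<Rightarrow>\<^sub>0 int) \<Rightarrow> 'm) \<Rightarrow> nat \<Rightarrow> ('m list \<Rightarrow>\<^sub>0 int) \<Rightarrow> ('m list \<Rightarrow>\<^sub>0 int) set"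
  where "gp_class act n c = gp_subgroup act n #>\<^bsub>free_Abelian_group {ms. length ms = n}\<^esub> c"

definition gp_cochain :: "('m list \<Rightarrow> 'a::ab_group_add) \<Rightarrow> ('m list \<Rightarrow>\<^sub>0 int) set \<Rightarrow> 'a"
  where "gp_cochain f = quotient_lift (free_lift additive_group f)"


section \<open>The maps\<close>

text \<open>A generator of the free abelian group on \<open>X \<times> X\<^sup>n\<close> is a list of length \<open>n + 1\<close>; a generator
  of the free abelian group on \<open>G\<^sup>n\<^sup>+\<^sup>1 \<times> M\<^sup>n\<^sup>+\<^sup>1\<close> is a pair of such lists.\<close>

definition mcb_proj :: "nat \<Rightarrow> (('m, 'g) mcb_symbol \<Rightarrow>\<^sub>0 int) \<Rightarrow> (('m \<times> 'g) list \<Rightarrow>\<^sub>0 int)"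
  where "mcb_proj n = frag_extend (\<lambda>(x0, bs).
    if length bs = n then frag_of (x0 # map hd bs) else 0)"

definition gamma_map ::
    "nat \<Rightarrow> (('m::ab_group_add \<times> 'g) list \<Rightarrow>\<^sub>0 int) \<Rightarrow> ('g list \<times> 'm list \<Rightarrow>\<^sub>0 int)"
  where "gamma_map n = frag_extend (\<lambda>xs. frag_of
    (map snd xs,
     map (\<lambda>i. if i < n then fst (xs ! i) - fst (xs ! Suc i) else fst (xs ! n)) [0..<Suc n]))"

text \<open>The product \<open>g\<^sub>a\<^sup>k\<^sup>a \<dots> g\<^sub>b\<^sup>k\<^sup>b\<close> in this order, for exponents \<open>k\<close> in \<open>{0, 1}\<close>; it is the
  unit if \<open>b < a\<close>.\<close>

definition word :: "'g::group_add list \<Rightarrow> (nat \<Rightarrow> nat) \<Rightarrow> nat \<Rightarrow> nat \<Rightarrow> 'g"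
  where "word gs k a b = sum_list (map (\<lambda>j. if k j = 0 then 0 else gs ! j) [a..<Suc b])"

text \<open>For \<open>i = 0\<close> the argument of \<open>\<phi>\<close> is the empty product.\<close>

definition psi_gen ::
    "('m::ab_group_add \<Rightarrow> ('g::group_add \<Rightarrow>\<^sub>0 int) \<Rightarrow> 'm) \<Rightarrow> ('g \<Rightarrow> 'g) \<Rightarrow> nat \<Rightarrow>
     'g list \<Rightarrow> 'm list \<Rightarrow> ('m list \<Rightarrow>\<^sub>0 int) set"
  where "psi_gen act \<phi> n gs ms = gp_class act (Suc n)
    (\<Sum>k\<in>{1..n} \<rightarrow>\<^sub>E {0, 1}. frag_cmul ((- 1) ^ (\<Sum>j = 1..n. k j))
      (frag_of (map (\<lambda>i. act (ms ! i) (frag_of (\<phi> (word gs k 1 i) + word gs k (Suc i) n)))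
                    [0..<Suc n])))"

definition psi_lambda ::
    "('m::ab_group_add \<Rightarrow> ('g::group_add \<Rightarrow>\<^sub>0 int) \<Rightarrow> 'm) \<Rightarrow> ('g \<Rightarrow> 'g) \<Rightarrow> ('g \<Rightarrow> 'a::ab_group_add) \<Rightarrow>
     nat \<Rightarrow> ('g list \<times> 'm list \<Rightarrow>\<^sub>0 int) \<Rightarrow> (('m list \<Rightarrow>\<^sub>0 int) set \<times> 'a \<Rightarrow>\<^sub>0 int) set"
  where "psi_lambda act \<phi> l n =
    free_lift (tensor_group (gp_C act (Suc n)) additive_group)
      (\<lambda>(gs, ms). pure_tensor (gp_C act (Suc n)) additive_group (psi_gen act \<phi> n gs ms) (l (gs ! 0)))"

text \<open>The map \<open>c \<otimes> a \<mapsto> f c \<otimes> a\<close>, with values in the tensor product of the coefficient group with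
  itself.\<close>

definition tensor_id ::
    "('m list \<Rightarrow> 'a::ab_group_add) \<Rightarrow> (('m list \<Rightarrow>\<^sub>0 int) set \<times> 'a \<Rightarrow>\<^sub>0 int) set \<Rightarrow> ('a \<times> 'a \<Rightarrow>\<^sub>0 int) set"
  where "tensor_id f = quotient_lift
    (free_lift (tensor_group additive_group additive_group)
      (\<lambda>(c, a). pure_tensor additive_group additive_group (gp_cochain f c) a))"

definition Phi_chain ::
    "('m::ab_group_add \<Rightarrow> ('g::group_add \<Rightarrow>\<^sub>0 int) \<Rightarrow> 'm) \<Rightarrow> ('g \<Rightarrow> 'g) \<Rightarrow> ('g \<Rightarrow> 'a::ab_group_add) \<Rightarrow>
     nat \<Rightarrow> ('m list \<Rightarrow> 'a) \<Rightarrow> (('m, 'g) mcb_symbol \<Rightarrow>\<^sub>0 int) \<Rightarrow> ('a \<times> 'a \<Rightarrow>\<^sub>0 int) set"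
  where "Phi_chain act \<phi> l n f = tensor_id f \<circ> psi_lambda act \<phi> l n \<circ> gamma_map n \<circ> mcb_proj n"

definition Phi ::
    "('m::ab_group_add \<Rightarrow> ('g::group_add \<Rightarrow>\<^sub>0 int) \<Rightarrow> 'm) \<Rightarrow> ('g \<Rightarrow> 'g) \<Rightarrow> ('g \<Rightarrow> 'a::ab_group_add) \<Rightarrow>
     nat \<Rightarrow> ('m list \<Rightarrow> 'a) \<Rightarrow> (('m, 'g) mcb_symbol \<Rightarrow>\<^sub>0 int) set \<Rightarrow> ('a \<times> 'a \<Rightarrow>\<^sub>0 int) set"
  where "Phi act \<phi> l n f = quotient_lift (Phi_chain act \<phi> l n f)"

end

theory Submission
  imports Defs
begin

text \<open>
  Write \<open>u\<^sub>i = m\<^sub>i - m\<^sub>i\<^sub>+\<^sub>1\<close> for \<open>i < n\<close> and \<open>u\<^sub>n = m\<^sub>n\<close>. The composite map takes the value of \<open>f\<close> at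
  the vertices \<open>(u\<^sub>0 \<^bold>g\<^sub>k\<^sub>,\<^sub>0, \<dots>, u\<^sub>n \<^bold>g\<^sub>k\<^sub>,\<^sub>n)\<close> of a cube, \<open>k \<in> {0,1}\<^sup>n\<close>, and adds them up with signs.
  Because \<open>\<phi>\<close> is central and multiplicative, the \<open>i\<close>-th translation is, up to the common factor
  \<open>\<phi>(g\<^sub>1\<^sup>k\<^sup>1 \<dots> g\<^sub>n\<^sup>k\<^sup>n)\<close>, which an invariant \<open>f\<close> does not see, translation by
  \<open>\<tau>(g\<^sub>i\<^sub>+\<^sub>1\<^sup>k \<dots> g\<^sub>n\<^sup>k)\<close>, where \<open>\<tau> g = \<phi>(g)\<^sup>-\<^sup>1 g\<close> is again a homomorphism. So the signed sum can be
  computed by reading \<open>g\<^sub>1, \<dots>, g\<^sub>n\<close> from left to right: at each \<open>g\<^sub>i\<close> the current list of entries is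
  either left alone or translated by \<open>\<tau> g\<^sub>i\<close>, and the second choice is subtracted. This is the
  recursion \<open>vertex_sum\<close>; \<open>vertex_sum_eq_sum\<close> identifies it with the cubical sum, and everything
  else is induction along this recursion, in every degree \<open>n\<close>.

  The explicit formulas follow from its two ends. At \<open>g\<^sub>1\<close> there is only one entry, so linearity
  turns the difference into the factor \<open>1 - \<phi>(g\<^sub>1)\<^sup>-\<^sup>1 g\<^sub>1\<close> (\<open>vertex_sum_first\<close>); at \<open>g\<^sub>n\<close> invariance moves
  the translation to the last entry, which gives \<open>1 - \<phi>(g\<^sub>n) g\<^sub>n\<^sup>-\<^sup>1\<close> (\<open>vertex_sum_last\<close>). Only \<open>g\<^sub>2\<close>
  remains in degree \<open>3\<close>, and it produces the two summands.

  The map descends to the quotient because two neighbouring elements of the same group \<open>G\<^sub>m\<close> make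
  some \<open>u\<^sub>i\<close> vanish, while the shuffles have fewer than \<open>n\<close> blocks and are killed by the projection.

  For the cocycle condition, the boundary of a symbol with \<open>k\<close> blocks of total length \<open>n + 1\<close>
  matters only for \<open>k = n + 1\<close> and \<open>k = n\<close>. For \<open>k = n + 1\<close>, both faces at the \<open>i\<close>-th element merge
  the neighbouring entries \<open>u\<^sub>i\<^sub>-\<^sub>1\<close> and \<open>u\<^sub>i\<close>, the upper one after translating the first of them.
  Linearity splits a merged entry into the two ways of omitting one of its parts, so the alternating
  sum over all faces telescopes (\<open>face_sum_eq\<close>) to the sums that omit the first or the last entry.
  These vanish: nothing else is moved by \<open>g\<^sub>1\<close>, and the last translation moves all remaining entries
  simultaneously (\<open>face_sum_zero\<close>). For \<open>k = n\<close> the block of length two contributes three terms, which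
  cancel because \<open>1 - \<tau>(gh) = (1 - \<tau> g) + (\<tau> g - \<tau>(gh))\<close> (\<open>vertex_sum_split\<close>).
\<close>

section \<open>Signs and omitted entries\<close>

text \<open>A class of abelian groups carries no multiplication by integers, so the sign
  \<open>(-1)\<^sup>j\<close> acts through this function.\<close>

definition signed :: "nat \<Rightarrow> 'a::ab_group_add \<Rightarrow> 'a"
  where "signed j x = (if even j then x else - x)"

lemma signed_0 [simp]: "signed 0 x = x"
  and signed_Suc [simp]: "signed (Suc j) x = - signed j x"
  and signed_zero [simp]: "signed j 0 = 0"
  and signed_diff: "signed j (x - y) = signed j x - signed j y"
  by (simp_all add: signed_def)

definition omit :: "nat \<Rightarrow> 'b list \<Rightarrow> 'b list"
  where "omit i v = take i v @ drop (Suc i) v"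

lemma omit_append [simp]: "i < length p \<Longrightarrow> omit i (p @ q) = omit i p @ q"
  by (simp add: omit_def)

lemma omit_0 [simp]: "omit 0 (x # v) = v"
  by (simp add: omit_def)

lemma omit_length [simp]: "omit (length p) (p @ x # q) = p @ q"
  by (simp add: omit_def)

lemma omit_Suc_length [simp]: "omit (Suc (length p)) (p @ y # x # q) = p @ y # q"
  by (simp add: omit_def)

lemma map_omit: "map h (omit i v) = omit i (map h v)"
  by (simp add: omit_def take_map drop_map)

section \<open>Homomorphisms on free abelian groups and their quotients\<close>

lemma comm_group_additive_group: "comm_group (additive_group :: 'a::ab_group_add monoid)"
  by (rule comm_groupI) (auto simp: additive_group_def intro: exI[of _ "- x" for x])

lemma additive_group_simps [simp]:
  "carrier additive_group = UNIV" "x \<otimes>\<^bsub>additive_group\<^esub> y = x + y" "\<one>\<^bsub>additive_group\<^esub> = 0"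
  by (simp_all add: additive_group_def)

lemma inv_additive_group [simp]: "inv\<^bsub>additive_group\<^esub> x = - x"
  using comm_group_additive_group by (intro group.inv_equality) (auto simp: comm_group_def)

text \<open>The values of \<open>h\<close> are assumed to lie in \<open>H\<close> everywhere, so that the lift is a homomorphism on the
  free abelian group over the whole type. Chains can then be mapped without keeping track of the
  basis elements that occur in them.\<close>

lemma free_lift_hom:
  fixes h :: "'s \<Rightarrow> 'b"
  assumes "comm_group H" "\<And>s. h s \<in> carrier H"
  shows "free_lift H h \<in> hom (free_Abelian_group UNIV) H"
proof -
  interpret comm_group H by fact
  have pow: "h s [^]\<^bsub>H\<^esub> (i :: int) \<in> carrier H" for s i
    using assms(2) by simp
  \<comment> \<open>A common finite index set makes the products for two chains comparable.\<close>
  have extend: "free_lift H h c = finprod H (\<lambda>s. h s [^]\<^bsub>H\<^esub> Poly_Mapping.lookup c s) I"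
    if "Poly_Mapping.keys c \<subseteq> I" "finite I" for c I
    unfolding free_lift_def
    by (rule finprod_mono_neutral_cong_left) (use that pow in \<open>auto simp: in_keys_iff\<close>)
  show ?thesis
  proof (rule homI)
    fix c :: "'s \<Rightarrow>\<^sub>0 int"
    show "free_lift H h c \<in> carrier H"
      unfolding free_lift_def using pow by (intro finprod_closed) auto
  next
    fix c d :: "'s \<Rightarrow>\<^sub>0 int"
    let ?I = "Poly_Mapping.keys c \<union> Poly_Mapping.keys d"
    have "Poly_Mapping.keys (c + d) \<subseteq> ?I" by (rule keys_add)
    then have "free_lift H h (c + d) = finprod H (\<lambda>s. h s [^]\<^bsub>H\<^esub> Poly_Mapping.lookup (c + d) s) ?I"
      by (intro extend) auto
    also have "\<dots> = finprod H (\<lambda>s. h s [^]\<^bsub>H\<^esub> Poly_Mapping.lookup c s \<otimes>\<^bsub>H\<^esub> h s [^]\<^bsub>H\<^esub> Poly_Mapping.lookup d s) ?I"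
      by (simp add: lookup_add int_pow_mult assms(2))
    also have "\<dots> = free_lift H h c \<otimes>\<^bsub>H\<^esub> free_lift H h d"
      using pow by (simp add: extend[of c ?I] extend[of d ?I] Pi_def)
    finally show "free_lift H h (c \<otimes>\<^bsub>free_Abelian_group UNIV\<^esub> d)
        = free_lift H h c \<otimes>\<^bsub>H\<^esub> free_lift H h d"
      by simp
  qed
qed

lemma free_lift_frag_of [simp]:
  assumes "comm_group H" "h s \<in> carrier H"
  shows "free_lift H h (frag_of s) = h s"
proof -
  interpret comm_group H by fact
  show ?thesis using assms(2) by (simp add: free_lift_def)
qed

context
  fixes B :: "('b, 'k) monoid_scheme" and h :: "('s \<Rightarrow>\<^sub>0 int) \<Rightarrow> 'b"
  assumes B: "group B" and h: "h \<in> hom (free_Abelian_group UNIV) B"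
begin

lemma frag_hom_closed: "h c \<in> carrier B"
  using hom_in_carrier[OF h, of c] by simp

lemma frag_hom_add: "h (c + d) = h c \<otimes>\<^bsub>B\<^esub> h d"
  using hom_mult[OF h, of c d] by simp

lemma frag_hom_zero: "h 0 = \<one>\<^bsub>B\<^esub>"
  using hom_one[OF h] B by simp

lemma frag_hom_minus: "h (- c) = inv\<^bsub>B\<^esub> h c"
proof -
  have "h (- c) \<otimes>\<^bsub>B\<^esub> h c = \<one>\<^bsub>B\<^esub>"
    by (simp add: frag_hom_zero flip: frag_hom_add)
  then show ?thesis
    using group.inv_equality[OF B] frag_hom_closed by metis
qed

lemma frag_hom_diff: "h (c - d) = h c \<otimes>\<^bsub>B\<^esub> inv\<^bsub>B\<^esub> h d"
  using frag_hom_add[of c "- d"] by (simp add: frag_hom_minus)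

lemma frag_hom_one_extend:
  assumes "\<And>s. s \<in> Poly_Mapping.keys c \<Longrightarrow> h (z s) = \<one>\<^bsub>B\<^esub>"
  shows "h (frag_extend z c) = \<one>\<^bsub>B\<^esub>"
proof -
  interpret group B by (rule B)
  have "Poly_Mapping.keys c \<subseteq> {s. h (z s) = \<one>\<^bsub>B\<^esub>}" using assms by blast
  then show ?thesis
    by (induction c rule: frag_induction) (simp_all add: frag_hom_zero frag_extend_diff frag_hom_diff)
qed

end

lemma frag_extend_hom: "frag_extend z \<in> hom (free_Abelian_group UNIV) (free_Abelian_group UNIV)"
  by (rule homI) (simp_all add: frag_extend_add)

text \<open>The coinvariant group chains, the tensor products and the quotient by the degenerate
  chains are free abelian groups modulo the subgroup generated by a set of relations. This locale
  treats the three constructions at once.\<close>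

locale presented_group =
  fixes S :: "'s set" and R :: "('s \<Rightarrow>\<^sub>0 int) set"
  assumes relations: "R \<subseteq> carrier (free_Abelian_group S)"
begin

abbreviation "K \<equiv> free_Abelian_group S"
abbreviation "N \<equiv> generate K R"

lemma subgroup: "subgroup N K"
  by (rule group.generate_is_subgroup[OF group_free_Abelian_group relations])

lemma normal: "N \<lhd> K"
  by (simp add: comm_group.normal_iff_subgroup[OF abelian_free_Abelian_group] subgroup)

lemma comm_group_quotient: "comm_group (K Mod N)"
  by (rule comm_group.abelian_FactGroup[OF abelian_free_Abelian_group subgroup])

lemma coset_closed: "c \<in> carrier K \<Longrightarrow> N #>\<^bsub>K\<^esub> c \<in> carrier (K Mod N)"
  by (simp add: carrier_FactGroup)

lemma coset_add:
  "c \<in> carrier K \<Longrightarrow> d \<in> carrier K \<Longrightarrow> (N #>\<^bsub>K\<^esub> c) <#>\<^bsub>K\<^esub> (N #>\<^bsub>K\<^esub> d) = N #>\<^bsub>K\<^esub> (c + d)"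
  using normal.rcos_sum[OF normal] by simp

lemma coset_eqI:
  assumes "c \<in> carrier K" "d \<in> carrier K" "c - d \<in> R"
  shows "N #>\<^bsub>K\<^esub> c = N #>\<^bsub>K\<^esub> d"
proof -
  have "c \<in> N #>\<^bsub>K\<^esub> d"
    using generate.incl[OF assms(3)] unfolding r_coset_def by force
  then show ?thesis
    using group.repr_independence[OF group_free_Abelian_group _ assms(2) subgroup] by simp
qed

context
  fixes B :: "('b, 'k) monoid_scheme" and h :: "('s \<Rightarrow>\<^sub>0 int) \<Rightarrow> 'b"
  assumes B: "group B" and h: "h \<in> hom (free_Abelian_group UNIV) B"
    and kills: "\<And>r. r \<in> R \<Longrightarrow> h r = \<one>\<^bsub>B\<^esub>"
begin

lemma hom_kills_subgroup: "r \<in> N \<Longrightarrow> h r = \<one>\<^bsub>B\<^esub>"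
proof (induction rule: generate.induct)
  case (inv r)
  interpret group B by (rule B)
  have "Poly_Mapping.keys r \<subseteq> S" using subsetD[OF relations inv] by simp
  then show ?case using inv kills by (simp add: frag_hom_minus[OF B h])
next
  case (eng r s)
  interpret group B by (rule B)
  show ?case using eng by (simp add: frag_hom_add[OF B h])
qed (use kills in \<open>simp_all add: frag_hom_zero[OF B h]\<close>)

text \<open>The multiplication of a free abelian group is addition of arbitrary chains, so \<open>h\<close> is constant on
  the translate of the subgroup by any chain \<open>c\<close>, and its image is a singleton.\<close>

lemma quotient_lift_coset: "quotient_lift h (N #>\<^bsub>K\<^esub> c) = h c"
proof -
  interpret group B by (rule B)
  have "h (r + c) = h c" if "r \<in> N" for r
    using hom_kills_subgroup[OF that] by (simp add: frag_hom_add[OF B h] frag_hom_closed[OF B h])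
  moreover have "0 \<in> N" using generate.one[of K R] by simp
  ultimately have "h ` (N #>\<^bsub>K\<^esub> c) = {h c}"
    by (force simp: r_coset_def)
  then show ?thesis by (simp add: quotient_lift_def)
qed

lemma quotient_lift_hom: "quotient_lift h \<in> hom (K Mod N) B"
  by (rule homI)
    (auto simp: carrier_FactGroup coset_add quotient_lift_coset frag_hom_closed[OF B h] frag_hom_add[OF B h])

end

end

lemma free_lift_additive:
  fixes f :: "'s \<Rightarrow> 'a::ab_group_add"
  shows free_lift_additive_sum: "free_lift additive_group f (sum c I) = (\<Sum>i\<in>I. free_lift additive_group f (c i))"
    and free_lift_additive_sign: "free_lift additive_group f (frag_cmul ((- 1) ^ j) z) = signed j (free_lift additive_group f z)"
    and free_lift_additive_frag_of: "free_lift additive_group f (frag_of s) = f s"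
proof -
  have A: "group (additive_group :: 'a monoid)" by (rule comm_group.axioms(2)[OF comm_group_additive_group])
  have hom: "free_lift additive_group f \<in> hom (free_Abelian_group UNIV) additive_group"
    by (rule free_lift_hom[OF comm_group_additive_group]) simp
  show "free_lift additive_group f (sum c I) = (\<Sum>i\<in>I. free_lift additive_group f (c i))"
    by (induction I rule: infinite_finite_induct)
      (simp_all add: frag_hom_zero[OF A hom] frag_hom_add[OF A hom])
  show "free_lift additive_group f (frag_cmul ((- 1) ^ j) z) = signed j (free_lift additive_group f z)"
    by (simp add: signed_def frag_hom_minus[OF A hom])
  show "free_lift additive_group f (frag_of s) = f s"
    by (simp add: free_lift_frag_of[OF comm_group_additive_group])
qed

section \<open>Tensor products\<close>

locale tensor_product =
  fixes G :: "('a, 'k) monoid_scheme" and H :: "('b, 'l) monoid_scheme"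
  assumes G: "comm_group G" and H: "comm_group H"

sublocale tensor_product \<subseteq> presented_group "carrier G \<times> carrier H" "tensor_relations G H"
  rewrites "generate (free_Abelian_group (carrier G \<times> carrier H)) (tensor_relations G H) = tensor_subgroup G H"
    and "free_Abelian_group (carrier G \<times> carrier H) Mod tensor_subgroup G H = tensor_group G H"
proof -
  interpret G: comm_group G by (rule G)
  interpret H: comm_group H by (rule H)
  have *: "Poly_Mapping.keys (a - b - c) \<subseteq> S"
    if "Poly_Mapping.keys a \<subseteq> S" "Poly_Mapping.keys b \<subseteq> S" "Poly_Mapping.keys c \<subseteq> S"
    for a b c :: "('a \<times> 'b) \<Rightarrow>\<^sub>0 int" and S
    using that keys_diff[of "a - b" c] keys_diff[of a b] by blast
  show "presented_group (carrier G \<times> carrier H) (tensor_relations G H)"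
  proof
    show "tensor_relations G H \<subseteq> carrier (free_Abelian_group (carrier G \<times> carrier H))"
      unfolding tensor_relations_def
      by (rule subsetI, elim UnE CollectE exE conjE) (simp_all add: *)
  qed
qed (simp_all add: tensor_subgroup_def tensor_group_def)

context tensor_product
begin

lemma comm_group_tensor_group: "comm_group (tensor_group G H)"
  by (rule comm_group_quotient)

lemma pure_tensor_closed:
  "x \<in> carrier G \<Longrightarrow> y \<in> carrier H \<Longrightarrow> pure_tensor G H x y \<in> carrier (tensor_group G H)"
  unfolding pure_tensor_def by (rule coset_closed) simp

lemma mult_tensor_group: "monoid.mult (tensor_group G H) = set_mult (free_Abelian_group (carrier G \<times> carrier H))"
  by (simp add: tensor_group_def)

lemma pure_tensor_add_left:
  assumes "x \<in> carrier G" "x' \<in> carrier G" "y \<in> carrier H"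
  shows "pure_tensor G H (x \<otimes>\<^bsub>G\<^esub> x') y = pure_tensor G H x y \<otimes>\<^bsub>tensor_group G H\<^esub> pure_tensor G H x' y"
proof -
  interpret G: comm_group G by (rule G)
  have "frag_of (x, y) + frag_of (x', y) \<in> carrier K"
    using assms by (auto intro!: order_trans[OF keys_add])
  moreover have "frag_of (x \<otimes>\<^bsub>G\<^esub> x', y) - (frag_of (x, y) + frag_of (x', y)) \<in> tensor_relations G H"
    using assms by (auto simp: tensor_relations_def diff_diff_eq)
  ultimately have "tensor_subgroup G H #>\<^bsub>K\<^esub> frag_of (x \<otimes>\<^bsub>G\<^esub> x', y) = tensor_subgroup G H #>\<^bsub>K\<^esub> (frag_of (x, y) + frag_of (x', y))"
    using assms by (intro coset_eqI) auto
  then show ?thesis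
    using assms by (simp add: pure_tensor_def mult_tensor_group coset_add)
qed

lemma pure_tensor_add_right:
  assumes "x \<in> carrier G" "y \<in> carrier H" "y' \<in> carrier H"
  shows "pure_tensor G H x (y \<otimes>\<^bsub>H\<^esub> y') = pure_tensor G H x y \<otimes>\<^bsub>tensor_group G H\<^esub> pure_tensor G H x y'"
proof -
  interpret H: comm_group H by (rule H)
  have "frag_of (x, y) + frag_of (x, y') \<in> carrier K"
    using assms by (auto intro!: order_trans[OF keys_add])
  moreover have "frag_of (x, y \<otimes>\<^bsub>H\<^esub> y') - (frag_of (x, y) + frag_of (x, y')) \<in> tensor_relations G H"
    using assms by (auto simp: tensor_relations_def diff_diff_eq)
  ultimately have "tensor_subgroup G H #>\<^bsub>K\<^esub> frag_of (x, y \<otimes>\<^bsub>H\<^esub> y') = tensor_subgroup G H #>\<^bsub>K\<^esub> (frag_of (x, y) + frag_of (x, y'))"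
    using assms by (intro coset_eqI) auto
  then show ?thesis
    using assms by (simp add: pure_tensor_def mult_tensor_group coset_add)
qed

lemma pure_tensor_hom: "y \<in> carrier H \<Longrightarrow> (\<lambda>x. pure_tensor G H x y) \<in> hom G (tensor_group G H)"
  by (rule homI) (simp_all add: pure_tensor_closed pure_tensor_add_left)

end

section \<open>Multilinear maps\<close>

lemma multilinear_add:
  assumes "multilinear n f" "length ps + length qs + 1 = n"
  shows "f (ps @ (x + y) # qs) = f (ps @ x # qs) + f (ps @ y # qs)"
proof -
  have "length (ps @ 0 # qs) = n" "length ps < n"
    using assms(2) by simp_all
  then have "Modules.additive (\<lambda>x. f ((ps @ 0 # qs)[length ps := x]))"
    using assms(1) unfolding multilinear_def by blast
  then show ?thesis by (simp add: Modules.additive_def)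
qed

lemma multilinear_zero:
  assumes "multilinear n f" "length v = n" "0 \<in> set v"
  shows "f v = 0"
proof -
  obtain ps qs where v: "v = ps @ 0 # qs" using assms(3) by (meson split_list)
  have "f (ps @ (0 + 0) # qs) = f (ps @ 0 # qs) + f (ps @ 0 # qs)"
    using assms v by (intro multilinear_add[of n]) auto
  then show ?thesis by (simp add: v)
qed

section \<open>Vertex sums\<close>

locale alexander_mcb = right_module act
  for act :: "'m::ab_group_add \<Rightarrow> ('g::group_add \<Rightarrow>\<^sub>0 int) \<Rightarrow> 'm"  (infixl \<open>\<cdot>\<close> 75) +
  fixes \<phi> :: "'g \<Rightarrow> 'g"
  assumes phi_hom: "\<phi> (g + h) = \<phi> g + \<phi> h"
    and phi_central: "\<phi> g + h = h + \<phi> g"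
begin

abbreviation translate :: "'m \<Rightarrow> 'g \<Rightarrow> 'm"  (infixl \<open>\<odot>\<close> 75)
  where "m \<odot> g \<equiv> m \<cdot> frag_of g"

lemma translate_add: "(x + y) \<odot> g = x \<odot> g + y \<odot> g"
  by (rule scale_add_left)

lemma translate_zero [simp]: "0 \<odot> g = 0"
  using translate_add[of 0 0 g] by simp

lemma translate_minus: "(- x) \<odot> g = - (x \<odot> g)"
  using translate_add[of x "- x" g] by (simp add: eq_neg_iff_add_eq_0 add.commute)

lemma translate_diff: "(x - y) \<odot> g = x \<odot> g - y \<odot> g"
  using translate_add[of x "- y" g] by (simp add: translate_minus)

lemma translate_translate [simp]: "m \<odot> g \<odot> h = m \<odot> (g + h)"
  by (simp add: mult_single flip: scale_mult)

lemma translate_0 [simp]: "m \<odot> 0 = m"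
  by (simp add: scale_one)

lemma scale_right_zero [simp]: "x \<cdot> 0 = 0"
  using scale_add_right[of x 0 0] by simp

lemma scale_right_minus: "x \<cdot> (- r) = - (x \<cdot> r)"
  using scale_add_right[of x r "- r"] by (simp add: eq_neg_iff_add_eq_0 add.commute)

lemma scale_right_diff: "x \<cdot> (r - s) = x \<cdot> r - x \<cdot> s"
  using scale_add_right[of x r "- s"] by (simp add: scale_right_minus)

lemma phi_zero [simp]: "\<phi> 0 = 0"
proof -
  have "\<phi> 0 + \<phi> 0 = \<phi> 0 + 0" using phi_hom[of 0 0] by simp
  then show ?thesis by (rule add_left_imp_eq)
qed

lemma phi_minus: "\<phi> (- g) = - \<phi> g"
  using phi_hom[of "- g" g] by (simp add: eq_neg_iff_add_eq_0)

lemma minus_phi_central: "- \<phi> g + h = h + - \<phi> g"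
  using phi_central[of "- g" h] by (simp add: phi_minus)

text \<open>This is the homomorphism \<open>g \<mapsto> \<phi>(g)\<^sup>-\<^sup>1 g\<close>, the part of a translation by \<open>g\<close> that remains when a common
  factor \<open>\<phi>(g)\<close> is divided out.\<close>

definition twist :: "'g \<Rightarrow> 'g"
  where "twist g = - \<phi> g + g"

lemma twist_zero [simp]: "twist 0 = 0"
  by (simp add: twist_def)

lemma twist_add: "twist (g + h) = twist g + twist h"
proof -
  have "twist (g + h) = - \<phi> h + (- \<phi> g + g) + h"
    by (simp add: twist_def phi_hom minus_add add.assoc del: add_uminus_conv_diff)
  also have "\<dots> = (- \<phi> g + g) + - \<phi> h + h"
    by (simp only: minus_phi_central[of h])
  finally show ?thesis by (simp add: twist_def add.assoc del: add_uminus_conv_diff)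
qed

text \<open>Conjugation does not change \<open>\<phi>\<close>, whose values are central; hence twisting commutes with it.\<close>

lemma twist_conj: "h + twist (- h + g + h) = twist g + h"
proof -
  have "\<phi> (- h + g + h) = \<phi> g"
    using phi_central[of g "\<phi> h"] by (simp add: phi_hom phi_minus add.assoc)
  then have "h + twist (- h + g + h) = h + - \<phi> g + (- h + g + h)"
    by (simp add: twist_def add.assoc del: add_uminus_conv_diff)
  also have "\<dots> = - \<phi> g + h + (- h + g + h)"
    by (simp only: minus_phi_central)
  finally show ?thesis by (simp add: twist_def add.assoc del: add_uminus_conv_diff)
qed

lemma twist_phi: "twist g + \<phi> g = g"
  by (metis add.assoc add_minus_cancel phi_central twist_def)

text \<open>Here \<open>p\<close> holds the entries \<open>u\<^sub>0, \<dots>, u\<^sub>i\<^sub>-\<^sub>1\<close> already formed and translated, \<open>m\<close> is the module part of the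
  element read last, and the list contains the elements still to be read. Keeping \<open>m\<close> rather than a
  difference makes omitting an element of the list the same as omitting it in a symbol. For the sum over
  a whole symbol, \<open>p\<close> starts empty and \<open>m\<close> is \<open>m\<^sub>0\<close>.\<close>

fun vertex_sum :: "('m list \<Rightarrow> 'a::ab_group_add) \<Rightarrow> 'm list \<Rightarrow> 'm \<Rightarrow> ('m \<times> 'g) list \<Rightarrow> 'a" where
  "vertex_sum f p m [] = f (p @ [m])"
| "vertex_sum f p m (x # xs) =
    vertex_sum f (p @ [m - fst x]) (fst x) xs
    - vertex_sum f (map (\<lambda>u. u \<odot> twist (snd x)) (p @ [m - fst x])) (fst x) xs"

declare vertex_sum.simps(2) [simp del]

lemmas vertex_sum_Cons = vertex_sum.simps(2)

lemma vertex_sum_add: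
  assumes "multilinear n f" "length ps + length qs + length xs + 2 = n"
  shows "vertex_sum f (ps @ (c + d) # qs) m xs
       = vertex_sum f (ps @ c # qs) m xs + vertex_sum f (ps @ d # qs) m xs"
  using assms(2)
proof (induction xs arbitrary: ps c d qs m)
  case Nil
  then show ?case using multilinear_add[OF assms(1), of ps "qs @ [m]"] by simp
next
  case (Cons x xs)
  show ?case
    using Cons.prems
    by (simp add: vertex_sum_Cons translate_add Cons.IH)
qed

lemma vertex_sum_zero:
  assumes "multilinear n f" "length p + length xs + 1 = n" "0 \<in> set p"
  shows "vertex_sum f p m xs = 0"
  using assms(2,3)
proof (induction xs arbitrary: p m)
  case Nil
  then show ?case using multilinear_zero[OF assms(1), of "p @ [m]"] by simp
next
  case (Cons x xs)
  have "0 \<in> (\<lambda>u. u \<odot> twist (snd x)) ` set p"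
    using Cons.prems(2) by (force intro: image_eqI[of _ _ 0])
  then show ?case
    using Cons.prems by (simp add: vertex_sum_Cons Cons.IH)
qed

text \<open>Equal module parts of neighbours make their difference an entry \<open>0\<close>, and translations keep it \<open>0\<close>.\<close>

lemma vertex_sum_degenerate:
  assumes "multilinear n f" "length p + length xs + length ys + 3 = n" "fst y = fst z"
  shows "vertex_sum f p m (xs @ y # z # ys) = 0"
  using assms(2)
proof (induction xs arbitrary: p m)
  case Nil
  then show ?case
    by (simp add: vertex_sum_Cons[of _ _ _ z] vertex_sum_Cons[of _ _ _ y] assms(3)
        vertex_sum_zero[OF assms(1)])
next
  case (Cons x xs)
  then show ?case by (simp add: vertex_sum_Cons)
qed

text \<open>The function \<open>v \<mapsto> f (omit i v)\<close> takes one more argument than \<open>f\<close>. Sums of such functions are the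
  terms into which the faces of a symbol decompose.\<close>

lemma vertex_sum_omit:
  assumes "i < length p"
  shows "vertex_sum (\<lambda>v. f (omit i v)) p m xs = vertex_sum f (omit i p) m xs"
  using assms
proof (induction xs arbitrary: p m)
  case (Cons x xs)
  have len: "i < length (p @ [m - fst x])"
    "i < length (map (\<lambda>u. u \<odot> twist (snd x)) (p @ [m - fst x]))"
    using Cons.prems by simp_all
  show ?case
    unfolding vertex_sum_Cons Cons.IH[OF len(1)] Cons.IH[OF len(2)]
    using Cons.prems by (simp flip: map_omit)
qed simp

text \<open>Linearity in the entry formed from \<open>a + b\<close>. The part \<open>a\<close> alone is obtained by keeping \<open>a\<close> and \<open>b\<close> as two
  separate entries and omitting the one formed from \<open>b\<close>.\<close>

lemma vertex_sum_merge:
  assumes "multilinear n f" "length p + length xs + 1 = n"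
  shows "vertex_sum f p (a + b) xs
       = vertex_sum (\<lambda>v. f (omit (Suc (length p)) v)) (p @ [a]) b xs + vertex_sum f p b xs"
proof (cases xs)
  case Nil
  then have "f (p @ [a + b]) = f (p @ [a]) + f (p @ [b])"
    using multilinear_add[OF assms(1), of p "[]"] assms(2) by simp
  then show ?thesis using Nil by simp
next
  case (Cons x ys)
  have 1: "vertex_sum (\<lambda>v. f (omit (Suc (length p)) v)) (p @ [a, b - fst x]) (fst x) ys
     = vertex_sum f (p @ [a]) (fst x) ys"
    by (subst vertex_sum_omit) simp_all
  have 2: "vertex_sum (\<lambda>v. f (omit (Suc (length p)) v))
       (map (\<lambda>u. u \<odot> twist (snd x)) (p @ [a, b - fst x])) (fst x) ys
     = vertex_sum f (map (\<lambda>u. u \<odot> twist (snd x)) (p @ [a])) (fst x) ys"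
    using omit_Suc_length[of "map (\<lambda>u. u \<odot> twist (snd x)) p" "a \<odot> twist (snd x)" "(b - fst x) \<odot> twist (snd x)" "[]"]
    by (subst vertex_sum_omit) simp_all
  have 3: "vertex_sum f (q @ [c + d]) m ys = vertex_sum f (q @ [c]) m ys + vertex_sum f (q @ [d]) m ys"
    if "length q = length p" for q c d m
    using vertex_sum_add[OF assms(1), of q "[]"] that assms(2) Cons by simp
  show ?thesis
    using 1 2 3[of p a "b - fst x"]
      3[of "map (\<lambda>u. u \<odot> twist (snd x)) p" "a \<odot> twist (snd x)" "(b - fst x) \<odot> twist (snd x)"]
    by (simp add: Cons vertex_sum_Cons add_diff_eq[symmetric] translate_add)
qed

lemma G_invariantD: "G_invariant act n f \<Longrightarrow> length v = n \<Longrightarrow> f (map (\<lambda>u. u \<odot> h) v) = f v"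
  unfolding G_invariant_def by blast

text \<open>Translating all module parts by \<open>h\<close> translates every vertex by \<open>h\<close>, provided that the group parts are
  conjugated accordingly; \<open>f\<close> does not see this.\<close>

lemma vertex_sum_translate:
  assumes "G_invariant act n f" "length p + length xs + 1 = n"
  shows "vertex_sum f (map (\<lambda>u. u \<odot> h) p) (m \<odot> h) (map (\<lambda>x. (fst x \<odot> h, - h + snd x + h)) xs)
       = vertex_sum f p m xs"
  using assms(2)
proof (induction xs arbitrary: p m)
  case Nil
  have "f (map (\<lambda>u. u \<odot> h) (p @ [m])) = f (p @ [m])"
    using Nil by (intro G_invariantD[OF assms(1)]) simp
  then show ?case by simp
next
  case (Cons x xs)
  have A: "map (\<lambda>u. u \<odot> h) p @ [m \<odot> h - fst x \<odot> h] = map (\<lambda>u. u \<odot> h) (p @ [m - fst x])"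
    by (simp add: translate_diff)
  have B: "map (\<lambda>u. u \<odot> twist (- h + snd x + h)) (map (\<lambda>u. u \<odot> h) q)
      = map (\<lambda>u. u \<odot> h) (map (\<lambda>u. u \<odot> twist (snd x)) q)" for q
    by (simp add: twist_conj)
  have IH: "vertex_sum f (map (\<lambda>u. u \<odot> h) q) (fst x \<odot> h)
      (map (\<lambda>x. (fst x \<odot> h, - h + snd x + h)) xs) = vertex_sum f q (fst x) xs"
    if "length q = Suc (length p)" for q
    using that Cons.prems by (intro Cons.IH) simp
  show ?case
    by (simp only: list.map vertex_sum_Cons fst_conv snd_conv A B IH length_map length_append_singleton)
qed

lemma vertex_sum_translate_central:
  assumes "G_invariant act n f" "length p + length xs + 1 = n"
  shows "vertex_sum f (map (\<lambda>u. u \<odot> \<phi> g) p) (m \<odot> \<phi> g) (map (\<lambda>x. (fst x \<odot> \<phi> g, snd x)) xs)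
       = vertex_sum f p m xs"
proof -
  have "- \<phi> g + x + \<phi> g = x" for x
    by (metis add.assoc minus_add_cancel phi_central)
  then show ?thesis
    using vertex_sum_translate[OF assms, of "\<phi> g" m] by simp
qed

text \<open>Up to the common translation by \<open>\<phi>(g)\<close>, the operation of \<open>y = (n, g)\<close> from below is the affine
  map \<open>m \<mapsto> (m - n) \<phi>(g)\<^sup>-\<^sup>1 g + n\<close> on module parts, together with conjugation on group parts, and the operation
  from above is the identity.\<close>

definition contract :: "'m \<times> 'g \<Rightarrow> 'm \<Rightarrow> 'm"
  where "contract y m = (m - fst y) \<odot> twist (snd y) + fst y"

definition contract_pair :: "'m \<times> 'g \<Rightarrow> 'm \<times> 'g \<Rightarrow> 'm \<times> 'g"
  where "contract_pair y x = (contract y (fst x), - snd y + snd x + snd y)"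

definition upper_face ::
    "('m list \<Rightarrow> 'a::ab_group_add) \<Rightarrow> 'm list \<Rightarrow> 'm \<Rightarrow> ('m \<times> 'g) list \<Rightarrow> 'm \<times> 'g \<Rightarrow> ('m \<times> 'g) list \<Rightarrow> 'a"
  where "upper_face f p m xs y ys =
    vertex_sum f (map (\<lambda>u. u \<odot> twist (snd y)) p) (contract y m) (map (contract_pair y) xs @ ys)"

lemma contract_phi: "contract y m \<odot> \<phi> (snd y) = m \<odot> snd y + fst y \<cdot> (frag_of (\<phi> (snd y)) - frag_of (snd y))"
  by (simp add: contract_def translate_add translate_diff twist_phi scale_right_diff)

text \<open>The common translation by the central element \<open>\<phi>(g)\<close> is removed by invariance.\<close>

lemma upper_face_eq:
  assumes "G_invariant act n f" "length xs + length ys + 1 = n"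
  shows "vertex_sum f [] (fst (under_op act \<phi> x0 y))
      (map (\<lambda>x. under_op act \<phi> x y) xs @ map (\<lambda>x. over_op act \<phi> x y) ys)
    = upper_face f [] (fst x0) xs y ys"
proof -
  have "under_op act \<phi> x y = (contract y (fst x) \<odot> \<phi> (snd y), - snd y + snd x + snd y)" for x
    by (simp add: under_op_def contract_phi case_prod_beta)
  moreover have "over_op act \<phi> x y = (fst x \<odot> \<phi> (snd y), snd x)" for x
    by (simp add: over_op_def case_prod_beta)
  ultimately show ?thesis
    using vertex_sum_translate_central[OF assms(1), of "[]" "map (contract_pair y) xs @ ys" "snd y" "contract y (fst x0)"]
      assms(2)
    by (simp add: upper_face_def contract_pair_def comp_def)
qed

text \<open>Contraction translates differences by \<open>\<tau> g\<^sub>y\<close>, and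
  \<open>\<tau>(g\<^sub>y) \<tau>(g\<^sub>y\<^sup>-\<^sup>1 g\<^sub>x g\<^sub>y) = \<tau>(g\<^sub>x) \<tau>(g\<^sub>y)\<close>. Therefore the faces obey the same recursion as the sum itself.\<close>

lemma upper_face_Cons:
  "upper_face f p m (x # xs) y ys
   = upper_face f (p @ [m - fst x]) (fst x) xs y ys
     - upper_face f (map (\<lambda>u. u \<odot> twist (snd x)) (p @ [m - fst x])) (fst x) xs y ys"
proof -
  have "contract y m - contract y (fst x) = (m - fst x) \<odot> twist (snd y)"
    by (simp add: contract_def translate_diff)
  moreover have "twist (snd y) + twist (- snd y + snd x + snd y) = twist (snd x) + twist (snd y)"
    by (simp flip: twist_add add: add.assoc[symmetric])
  ultimately show ?thesis
    by (simp add: upper_face_def vertex_sum_Cons contract_pair_def comp_def)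
qed

text \<open>When \<open>(n, g + h)\<close> is read, the difference of the untranslated and the translated sum is
  \<open>1 - \<tau>(gh) = (1 - \<tau> g) + (\<tau> g - \<tau> g \<tau> h)\<close>, and the second part is what reading \<open>(n, h)\<close> contributes after the
  entries before it have been contracted by \<open>(n, g)\<close>. This expresses the cancellation of the three
  terms coming from a block of length two.\<close>

lemma vertex_sum_split:
  "vertex_sum f p m (xs @ (n, g + h) # ys)
   = vertex_sum f p m (xs @ (n, g) # ys) + upper_face f p m xs (n, g) ((n, h) # ys)"
proof (induction xs arbitrary: p m)
  case Nil
  show ?case
    by (simp add: upper_face_def vertex_sum_Cons contract_def comp_def twist_add)
next
  case (Cons x xs)
  then show ?case by (simp add: vertex_sum_Cons upper_face_Cons)
qed

text \<open>The value on the boundary of a symbol all of whose blocks have length one.\<close>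

definition face_sum :: "('m list \<Rightarrow> 'a::ab_group_add) \<Rightarrow> 'm list \<Rightarrow> 'm \<Rightarrow> ('m \<times> 'g) list \<Rightarrow> 'a"
  where "face_sum f p m xs = (\<Sum>i<length xs. signed i
    (upper_face f p m (take i xs) (xs ! i) (drop (Suc i) xs)
     - vertex_sum f p m (take i xs @ drop (Suc i) xs)))"

lemma face_sum_Cons:
  "face_sum f p m (x # xs)
   = upper_face f p m [] x xs - vertex_sum f p m xs
     - (face_sum f (p @ [m - fst x]) (fst x) xs
        - face_sum f (map (\<lambda>u. u \<odot> twist (snd x)) (p @ [m - fst x])) (fst x) xs)"
  unfolding face_sum_def
  by (simp only: length_Cons sum.lessThan_Suc_shift)
    (simp add: upper_face_Cons vertex_sum_Cons signed_diff sum_subtractf sum_negf)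

text \<open>Each of the two faces at the first element \<open>x\<close> merges the entries at positions \<open>q\<close> and \<open>q + 1\<close>,
  \<open>q\<close> being the length of \<open>p\<close>, so their difference is minus the sum of the terms omitting position \<open>q\<close>
  and position \<open>q + 1\<close>. By induction the remaining faces contribute the term omitting \<open>q + 1\<close> with the
  opposite sign, together with the term omitting the last position; only the omissions of \<open>q\<close> and of
  the last position survive.\<close>

lemma face_sum_eq:
  assumes "multilinear n f" "length p + length xs = n"
  shows "face_sum f p m xs = signed (length xs) (vertex_sum (\<lambda>v. f (butlast v)) p m xs)
     - vertex_sum (\<lambda>v. f (omit (length p) v)) p m xs"
  using assms(2)
proof (induction xs arbitrary: p m)
  case Nil
  show ?case by (simp add: face_sum_def)
next
  case (Cons x xs)
  let ?t = "\<lambda>p. map (\<lambda>u. u \<odot> twist (snd x)) p" and ?p = "p @ [m - fst x]"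
  have low: "vertex_sum f p m xs
      = vertex_sum (\<lambda>v. f (omit (Suc (length p)) v)) ?p (fst x) xs
        + vertex_sum (\<lambda>v. f (omit (length p) v)) ?p (fst x) xs"
    using vertex_sum_merge[OF assms(1), of p xs "m - fst x" "fst x"] Cons.prems
    by (simp add: vertex_sum_omit)
  have up: "upper_face f p m [] x xs
      = vertex_sum (\<lambda>v. f (omit (Suc (length p)) v)) (?t ?p) (fst x) xs
        + vertex_sum (\<lambda>v. f (omit (length p) v)) (?t ?p) (fst x) xs"
    using vertex_sum_merge[OF assms(1), of "?t p" xs "(m - fst x) \<odot> twist (snd x)" "fst x"] Cons.prems
      omit_length[of "?t p" "(m - fst x) \<odot> twist (snd x)" "[]"]
    by (simp add: vertex_sum_omit upper_face_def contract_def)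
  show ?case
    using Cons.IH[of ?p "fst x"] Cons.IH[of "?t ?p" "fst x"] Cons.prems
    by (simp add: face_sum_Cons low up vertex_sum_Cons signed_diff algebra_simps)
qed

text \<open>The first element read translates only the first entry, and that entry is omitted.\<close>

lemma vertex_sum_omit_first: "vertex_sum (\<lambda>v. f (omit 0 v)) [] m (x # xs) = 0"
  by (simp add: vertex_sum_Cons vertex_sum_omit)

text \<open>The last element read translates all entries other than the last one simultaneously, so without the
  last entry it has no effect on an invariant function.\<close>

lemma vertex_sum_butlast:
  assumes "G_invariant act n f" "length p + length xs = n" "xs \<noteq> []"
  shows "vertex_sum (\<lambda>v. f (butlast v)) p m xs = 0"
  using assms(2,3)
proof (induction xs arbitrary: p m)
  case (Cons x xs)
  show ?case
  proof (cases "xs = []")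
    case True
    have "f (map (\<lambda>u. u \<odot> twist (snd x)) (p @ [m - fst x])) = f (p @ [m - fst x])"
      using Cons.prems(1) True by (intro G_invariantD[OF assms(1)]) simp
    then show ?thesis by (simp add: True vertex_sum_Cons butlast_append)
  next
    case False
    then show ?thesis using Cons by (simp add: vertex_sum_Cons)
  qed
qed simp

lemma face_sum_zero:
  assumes "multilinear n f" "G_invariant act n f" "length xs = n" "xs \<noteq> []"
  shows "face_sum f [] m xs = 0"
proof -
  obtain x ys where "xs = x # ys" using assms(4) by (cases xs) auto
  then show ?thesis
    using assms vertex_sum_omit_first[of f m x ys]
    by (simp add: face_sum_eq[OF assms(1)] vertex_sum_butlast[OF assms(2)])
qed

end

section \<open>Vertex sums as sums over a cube\<close>

lemma sum_PiE_insert: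
  assumes "x \<notin> S"
  shows "sum h (insert x S \<rightarrow>\<^sub>E {0, 1::nat})
       = (\<Sum>k\<in>S \<rightarrow>\<^sub>E {0, 1}. h (k(x := 0))) + (\<Sum>k\<in>S \<rightarrow>\<^sub>E {0, 1}. h (k(x := 1)))"
proof -
  have "inj_on (\<lambda>(y, k). k(x := y)) ({0, 1::nat} \<times> (S \<rightarrow>\<^sub>E {0, 1}))"
    using inj_combinator[OF assms, of "\<lambda>_. {0, 1::nat}"] by simp
  then have "sum h (insert x S \<rightarrow>\<^sub>E {0, 1::nat})
      = (\<Sum>(y, k)\<in>{0, 1} \<times> (S \<rightarrow>\<^sub>E {0, 1}). h (k(x := y)))"
    unfolding PiE_insert_eq by (simp add: sum.reindex comp_def case_prod_unfold)
  then show ?thesis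
    by (simp flip: sum.cartesian_product)
qed

context alexander_mcb
begin

declare scale_one [simp]

definition difference :: "('m \<times> 'g) list \<Rightarrow> nat \<Rightarrow> 'm"
  where "difference xs i = (if Suc i < length xs then fst (xs ! i) - fst (xs ! Suc i) else fst (xs ! i))"

text \<open>After \<open>a\<close> elements have been read, the entries \<open>0, \<dots>, a - 1\<close> and the entry \<open>u\<^sub>a\<close> formed next are
  translated by every later element, whereas \<open>u\<^sub>i\<close> with \<open>i > a\<close> is translated only by the elements
  after the \<open>i\<close>-th; hence the lower end \<open>max i a + 1\<close>. The induction runs from \<open>a = n\<close> downwards and splits
  the cube along the coordinate \<open>a + 1\<close>.\<close>

lemma vertex_sum_drop_eq_sum:
  fixes f :: "'m list \<Rightarrow> 'b::ab_group_add"
  assumes "length xs = Suc n" "a \<le> n" "length p = a"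
  shows "vertex_sum f p (fst (xs ! a)) (drop (Suc a) xs)
    = (\<Sum>k\<in>{Suc a..n} \<rightarrow>\<^sub>E {0, 1}. signed (\<Sum>j = Suc a..n. k j)
        (f (map (\<lambda>i. (if i < a then p ! i else difference xs i)
              \<odot> twist (word (map snd xs) k (Suc (max i a)) n)) [0..<Suc n])))"
  using assms(2,3)
proof (induction a arbitrary: p rule: inc_induct)
  case base
  have "p @ [fst (xs ! n)] = map (\<lambda>i. if i < n then p ! i else difference xs i) [0..<Suc n]"
    using base assms(1) by (auto simp: difference_def map_nth intro!: nth_equalityI simp: nth_append less_Suc_eq)
  moreover have "word (map snd xs) k (Suc (max i n)) n = 0" for k i
    unfolding word_def by (subst upt_conv_Nil) simp_all
  ultimately show ?case using assms(1) by (simp del: upt_Suc)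
next
  case (step a)
  let ?gs = "map snd xs" and ?x = "xs ! Suc a" and ?S = "{Suc (Suc a)..n}"
  let ?p = "p @ [difference xs a]"
  let ?v = "\<lambda>k i. (if i < a then p ! i else difference xs i) \<odot> twist (word ?gs k (Suc (max i a)) n)"
  have len: "length ?p = Suc a" and len': "length (map (\<lambda>u. u \<odot> twist (snd ?x)) ?p) = Suc a"
    using step.prems by simp_all
  have ins: "{Suc a..n} = insert (Suc a) ?S" using step.hyps by auto
  have split: "sum h ({Suc a..n} \<rightarrow>\<^sub>E {0, 1::nat})
      = (\<Sum>k\<in>?S \<rightarrow>\<^sub>E {0, 1}. h (k(Suc a := 0))) + (\<Sum>k\<in>?S \<rightarrow>\<^sub>E {0, 1}. h (k(Suc a := 1)))"
    for h :: "(nat \<Rightarrow> nat) \<Rightarrow> 'b"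
    unfolding ins by (rule sum_PiE_insert) simp
  have drop: "drop (Suc a) xs = ?x # drop (Suc (Suc a)) xs"
    using step.hyps assms(1) by (simp add: Cons_nth_drop_Suc)
  have diff: "difference xs a = fst (xs ! a) - fst ?x"
    using step.hyps assms(1) by (simp add: difference_def)
  have word_late: "word ?gs (k(Suc a := y)) (Suc i) n = word ?gs k (Suc i) n" if "a < i" for k y i
    using that unfolding word_def by (intro arg_cong[of _ _ sum_list] map_cong) auto
  have word_early: "word ?gs (k(Suc a := y)) (Suc a) n
      = (if y = 0 then 0 else snd ?x) + word ?gs k (Suc (Suc a)) n" for k y
  proof -
    have "[Suc a..<Suc n] = Suc a # [Suc (Suc a)..<Suc n]"
      using step.hyps by (simp add: upt_conv_Cons)
    then show ?thesis
      using word_late[of "Suc a" k y] step.hyps assms(1) by (simp add: word_def)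
  qed
  have v0: "map (?v (k(Suc a := 0))) [0..<Suc n]
      = map (\<lambda>i. (if i < Suc a then ?p ! i else difference xs i)
          \<odot> twist (word ?gs k (Suc (max i (Suc a))) n)) [0..<Suc n]" for k
    using step.prems
    by (intro map_cong) (auto simp: max_def nth_append word_late word_early not_less le_Suc_eq less_Suc_eq)
  have v1: "map (?v (k(Suc a := 1))) [0..<Suc n]
      = map (\<lambda>i. (if i < Suc a then map (\<lambda>u. u \<odot> twist (snd ?x)) ?p ! i else difference xs i)
          \<odot> twist (word ?gs k (Suc (max i (Suc a))) n)) [0..<Suc n]" for k
    using step.prems
    by (intro map_cong)
      (auto simp: max_def nth_append word_late word_early twist_add not_less le_Suc_eq less_Suc_eq)
  have exponent: "(\<Sum>j = Suc a..n. (k(Suc a := y)) j) = y + (\<Sum>j = Suc (Suc a)..n. k j)" for k and y :: nat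
  proof -
    have "(\<Sum>j\<in>?S. (k(Suc a := y)) j) = (\<Sum>j\<in>?S. k j)" by (intro sum.cong) auto
    then show ?thesis unfolding ins by simp
  qed
  have "vertex_sum f p (fst (xs ! a)) (drop (Suc a) xs)
      = vertex_sum f ?p (fst ?x) (drop (Suc (Suc a)) xs)
        - vertex_sum f (map (\<lambda>u. u \<odot> twist (snd ?x)) ?p) (fst ?x) (drop (Suc (Suc a)) xs)"
    by (simp add: drop vertex_sum_Cons diff)
  also have "\<dots> = (\<Sum>k\<in>{Suc a..n} \<rightarrow>\<^sub>E {0, 1}. signed (\<Sum>j = Suc a..n. k j)
        (f (map (?v k) [0..<Suc n])))"
    unfolding split exponent v0 v1 step.IH[OF len] step.IH[OF len']
    by (simp add: sum_negf del: upt_Suc)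
  finally show ?case .
qed

text \<open>By centrality \<open>\<phi>(v) w = \<tau>(w) \<phi>(v w)\<close>. With \<open>v\<close> and \<open>w\<close> the words up to and after position \<open>i\<close>, the
  factor \<open>\<phi>(v w)\<close> is the same for all entries.\<close>

lemma vertex_sum_eq_sum:
  assumes "G_invariant act (Suc n) f" "length xs = Suc n"
  shows "vertex_sum f [] (fst (hd xs)) (tl xs)
    = (\<Sum>k\<in>{1..n} \<rightarrow>\<^sub>E {0, 1}. signed (\<Sum>j = 1..n. k j)
        (f (map (\<lambda>i. difference xs i \<odot> (\<phi> (word (map snd xs) k 1 i) + word (map snd xs) k (Suc i) n))
          [0..<Suc n])))"
proof -
  let ?w = "word (map snd xs)"
  have "f (map (\<lambda>i. difference xs i \<odot> (\<phi> (?w k 1 i) + ?w k (Suc i) n)) [0..<Suc n])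
      = f (map (\<lambda>i. difference xs i \<odot> twist (?w k (Suc i) n)) [0..<Suc n])" for k
  proof -
    have "twist (?w k (Suc i) n) + \<phi> (?w k 1 n) = \<phi> (?w k 1 i) + ?w k (Suc i) n" if "i \<le> n" for i
    proof -
      have "[1..<Suc n] = [1..<Suc i] @ [Suc i..<Suc n]"
        using upt_add_eq_append[of 1 "Suc i" "n - i"] that by simp
      then have "?w k 1 n = ?w k 1 i + ?w k (Suc i) n" by (simp add: word_def)
      then have "\<phi> (?w k 1 n) = \<phi> (?w k (Suc i) n) + \<phi> (?w k 1 i)"
        by (simp add: phi_hom phi_central[of _ "\<phi> (?w k (Suc i) n)"])
      then have "twist (?w k (Suc i) n) + \<phi> (?w k 1 n) = ?w k (Suc i) n + \<phi> (?w k 1 i)"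
        by (simp add: twist_phi flip: add.assoc)
      then show ?thesis by (simp add: phi_central[of _ "?w k (Suc i) n"])
    qed
    then have "map (\<lambda>i. difference xs i \<odot> (\<phi> (?w k 1 i) + ?w k (Suc i) n)) [0..<Suc n]
        = map (\<lambda>u. u \<odot> \<phi> (?w k 1 n)) (map (\<lambda>i. difference xs i \<odot> twist (?w k (Suc i) n)) [0..<Suc n])"
      by (simp add: less_Suc_eq_le)
    then show ?thesis
      by (simp only: G_invariantD[OF assms(1)] length_map length_upt diff_zero)
  qed
  then show ?thesis
    using vertex_sum_drop_eq_sum[OF assms(2), of 0 "[]" f] assms(2)
    by (cases xs) (simp_all add: drop_Suc)
qed

section \<open>Closed form at the two ends\<close>

lemma vertex_sum_first:
  assumes "multilinear n f" "length xs + 2 = n"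
  shows "vertex_sum f [] m (x # xs)
       = vertex_sum f [(m - fst x) \<cdot> (1 - frag_of (twist (snd x)))] (fst x) xs"
proof -
  let ?u = "m - fst x"
  have "?u = ?u \<cdot> (1 - frag_of (twist (snd x))) + ?u \<odot> twist (snd x)"
    by (simp add: scale_right_diff scale_one)
  then have "vertex_sum f [?u] (fst x) xs = vertex_sum f [?u \<cdot> (1 - frag_of (twist (snd x)))] (fst x) xs
      + vertex_sum f [?u \<odot> twist (snd x)] (fst x) xs"
    using vertex_sum_add[OF assms(1), of "[]" "[]" xs "?u \<cdot> (1 - frag_of (twist (snd x)))" "?u \<odot> twist (snd x)" "fst x"] assms(2)
    by (simp flip: \<open>?u = _\<close>)
  then show ?thesis by (simp add: vertex_sum_Cons)
qed

lemma vertex_sum_last: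
  assumes "multilinear n f" "G_invariant act n f" "length p + 2 = n"
  shows "vertex_sum f p m [x] = f (p @ [m - fst x, fst x \<cdot> (1 - frag_of (\<phi> (snd x) + - snd x))])"
proof -
  let ?b = "\<phi> (snd x) + - snd x" and ?q = "p @ [m - fst x]"
  \<comment> \<open>Translation by the twist is undone on the last entry, so it can be applied to all entries.\<close>
  have "?b + twist (snd x) = 0"
    using minus_phi_central[of "snd x" "snd x"] by (simp add: twist_def add.assoc del: add_uminus_conv_diff)
  then have "map (\<lambda>u. u \<odot> twist (snd x)) (?q @ [fst x \<odot> ?b]) = map (\<lambda>u. u \<odot> twist (snd x)) ?q @ [fst x]"
    by simp
  then have "f (map (\<lambda>u. u \<odot> twist (snd x)) ?q @ [fst x]) = f (?q @ [fst x \<odot> ?b])"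
    using G_invariantD[OF assms(2), of "?q @ [fst x \<odot> ?b]" "twist (snd x)"] assms(3) by simp
  moreover have "f (?q @ [fst x \<cdot> (1 - frag_of ?b) + fst x \<odot> ?b])
      = f (?q @ [fst x \<cdot> (1 - frag_of ?b)]) + f (?q @ [fst x \<odot> ?b])"
    using multilinear_add[OF assms(1), of ?q "[]"] assms(3) by simp
  ultimately show ?thesis
    by (simp add: vertex_sum_Cons scale_right_diff scale_one)
qed

end

section \<open>The chain map\<close>

locale alexander_cocycle = alexander_mcb act \<phi>
  for act :: "'m::ab_group_add \<Rightarrow> ('g::group_add \<Rightarrow>\<^sub>0 int) \<Rightarrow> 'm"  (infixl \<open>\<cdot>\<close> 75)
    and \<phi> :: "'g \<Rightarrow> 'g" +
  fixes l :: "'g \<Rightarrow> 'a::ab_group_add" and n :: nat and f :: "'m list \<Rightarrow> 'a"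
  assumes lambda_hom: "l (g + h) = l g + l h"
    and multilinear: "multilinear (Suc n) f"
    and invariant: "G_invariant act (Suc n) f"
begin

abbreviation A :: "'a monoid" where "A \<equiv> additive_group"
abbreviation AA :: "('a \<times> 'a \<Rightarrow>\<^sub>0 int) set monoid" where "AA \<equiv> tensor_group A A"
abbreviation \<Phi> where "\<Phi> \<equiv> Phi_chain act \<phi> l n f"

lemma lambda_conj: "l (- h + g + h) = l g"
proof -
  have "l 0 = 0" using lambda_hom[of 0 0] by simp
  then have "l (- h) = - l h"
    using lambda_hom[of "- h" h] by (simp add: eq_neg_iff_add_eq_0)
  then show ?thesis by (simp add: lambda_hom)
qed

lemma group_A: "group A"
  by (rule comm_group.axioms(2)[OF comm_group_additive_group])

lemma gp_presented:
  "presented_group {ms. length ms = Suc n}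
    {frag_of (map (\<lambda>m. act m (frag_of g)) ms) - frag_of ms | g ms. length ms = Suc n}"
proof
  have "Poly_Mapping.keys (frag_of (map (\<lambda>m. m \<odot> g) ms) - frag_of ms) \<subseteq> {ms. length ms = Suc n}"
    if "length ms = Suc n" for g ms
    using keys_diff[of "frag_of (map (\<lambda>m. m \<odot> g) ms)" "frag_of ms"] that by auto
  then show "{frag_of (map (\<lambda>m. act m (frag_of g)) ms) - frag_of ms | g ms. length ms = Suc n}
      \<subseteq> carrier (free_Abelian_group {ms. length ms = Suc n})"
    by (safe; unfold carrier_free_Abelian_group_iff; blast)
qed

lemma comm_group_gp_C: "comm_group (gp_C act (Suc n))"
  using presented_group.comm_group_quotient[OF gp_presented]
  by (simp add: gp_C_def gp_subgroup_def)

lemma evaluation_hom: "free_lift A f \<in> hom (free_Abelian_group UNIV) A"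
  by (rule free_lift_hom[OF comm_group_additive_group]) simp

lemma evaluation_kills:
  assumes "r \<in> {frag_of (map (\<lambda>m. act m (frag_of g)) ms) - frag_of ms | g ms. length ms = Suc n}"
  shows "free_lift A f r = \<one>\<^bsub>A\<^esub>"
  using assms
  by (auto simp: frag_hom_diff[OF group_A evaluation_hom] free_lift_additive_frag_of G_invariantD[OF invariant])

lemma gp_cochain_class: "gp_cochain f (gp_class act (Suc n) c) = free_lift A f c"
  using presented_group.quotient_lift_coset[OF gp_presented group_A evaluation_hom evaluation_kills]
  by (simp add: gp_cochain_def gp_class_def gp_subgroup_def)

lemma gp_cochain_hom: "gp_cochain f \<in> hom (gp_C act (Suc n)) A"
  using presented_group.quotient_lift_hom[OF gp_presented group_A evaluation_hom evaluation_kills]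
  by (simp add: gp_cochain_def gp_C_def gp_subgroup_def)

sublocale AA: tensor_product A A
  by (intro tensor_product.intro comm_group_additive_group)

sublocale CA: tensor_product "gp_C act (Suc n)" A
  by (intro tensor_product.intro comm_group_gp_C comm_group_additive_group)

lemma comm_group_AA: "comm_group AA"
  by (rule AA.comm_group_tensor_group)

lemma group_AA: "group AA"
  by (rule comm_group.axioms(2)[OF comm_group_AA])

lemma pure_tensor_closed_AA: "pure_tensor A A x y \<in> carrier AA"
  by (rule AA.pure_tensor_closed) simp_all

lemma tensor_id_inner_hom:
  "free_lift AA (\<lambda>(c, a). pure_tensor A A (gp_cochain f c) a) \<in> hom (free_Abelian_group UNIV) AA"
  by (rule free_lift_hom[OF comm_group_AA]) (auto simp: pure_tensor_closed_AA)

lemma tensor_id_kills: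
  assumes "r \<in> tensor_relations (gp_C act (Suc n)) A"
  shows "free_lift AA (\<lambda>(c, a). pure_tensor A A (gp_cochain f c) a) r = \<one>\<^bsub>AA\<^esub>"
proof -
  interpret AA': comm_group AA by (rule comm_group_AA)
  let ?h = "\<lambda>(c, a). pure_tensor A A (gp_cochain f c) a"
  have cancel: "(x \<otimes>\<^bsub>AA\<^esub> y) \<otimes>\<^bsub>AA\<^esub> inv\<^bsub>AA\<^esub> x \<otimes>\<^bsub>AA\<^esub> inv\<^bsub>AA\<^esub> y = \<one>\<^bsub>AA\<^esub>"
    if "x \<in> carrier AA" "y \<in> carrier AA" for x y
    using that by (simp add: AA'.m_assoc AA'.m_comm[of x y] AA'.inv_solve_left)
  have pure: "free_lift AA ?h (frag_of (c, a)) = pure_tensor A A (gp_cochain f c) a" for c a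
    by (simp add: free_lift_frag_of[OF comm_group_AA] pure_tensor_closed_AA)
  have left: "pure_tensor A A (x + y) a = pure_tensor A A x a \<otimes>\<^bsub>AA\<^esub> pure_tensor A A y a" for x y a
    using AA.pure_tensor_add_left[of x y a] by simp
  have right: "pure_tensor A A x (a + b) = pure_tensor A A x a \<otimes>\<^bsub>AA\<^esub> pure_tensor A A x b" for x a b
    using AA.pure_tensor_add_right[of x a b] by simp
  have "gp_cochain f (x \<otimes>\<^bsub>gp_C act (Suc n)\<^esub> y) = gp_cochain f x + gp_cochain f y"
    if "x \<in> carrier (gp_C act (Suc n))" "y \<in> carrier (gp_C act (Suc n))" for x y
    using hom_mult[OF gp_cochain_hom that] by simp
  then show ?thesis
    using assms unfolding tensor_relations_def
    by (elim UnE CollectE exE conjE)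
      (simp_all add: frag_hom_diff[OF group_AA tensor_id_inner_hom] pure left right cancel pure_tensor_closed_AA)
qed

lemma tensor_id_hom: "tensor_id f \<in> hom (tensor_group (gp_C act (Suc n)) A) AA"
  unfolding tensor_id_def
  by (rule CA.quotient_lift_hom[OF group_AA tensor_id_inner_hom tensor_id_kills])

lemma tensor_id_pure:
  "tensor_id f (pure_tensor (gp_C act (Suc n)) A c a) = pure_tensor A A (gp_cochain f c) a"
  using CA.quotient_lift_coset[OF group_AA tensor_id_inner_hom tensor_id_kills, of "frag_of (c, a)"]
  by (simp add: tensor_id_def pure_tensor_def[of "gp_C act (Suc n)"] free_lift_frag_of[OF comm_group_AA]
      pure_tensor_closed_AA)

lemma psi_gen_closed: "psi_gen act \<phi> n gs ms \<in> carrier (gp_C act (Suc n))"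
proof -
  have "Poly_Mapping.keys (frag_cmul i (frag_of (map h [0..<Suc n]))) \<subseteq> {ms. length ms = Suc n}"
    for h :: "nat \<Rightarrow> 'm" and i
    using keys_cmul[of i "frag_of (map h [0..<Suc n])"] by auto
  then show ?thesis
    unfolding psi_gen_def gp_class_def gp_C_def gp_subgroup_def
    by (intro presented_group.coset_closed[OF gp_presented] sum_closed_free_Abelian_group)
      (simp del: upt_Suc)
qed

lemma psi_lambda_hom:
  "psi_lambda act \<phi> l n \<in> hom (free_Abelian_group UNIV) (tensor_group (gp_C act (Suc n)) A)"
  unfolding psi_lambda_def
  by (rule free_lift_hom[OF CA.comm_group_tensor_group])
    (auto intro!: CA.pure_tensor_closed psi_gen_closed split: prod.split)

lemma psi_lambda_frag_of:
  "psi_lambda act \<phi> l n (frag_of (gs, ms))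
    = pure_tensor (gp_C act (Suc n)) A (psi_gen act \<phi> n gs ms) (l (gs ! 0))"
  unfolding psi_lambda_def
  by (simp add: free_lift_frag_of[OF CA.comm_group_tensor_group] CA.pure_tensor_closed psi_gen_closed)

lemma Phi_chain_hom: "\<Phi> \<in> hom (free_Abelian_group UNIV) AA"
  unfolding Phi_chain_def mcb_proj_def gamma_map_def
  by (intro hom_compose[OF frag_extend_hom] hom_compose[OF psi_lambda_hom] tensor_id_hom)

lemma gp_cochain_psi_gen:
  assumes "length xs = Suc n"
  shows "gp_cochain f (psi_gen act \<phi> n (map snd xs)
      (map (\<lambda>i. if i < n then fst (xs ! i) - fst (xs ! Suc i) else fst (xs ! n)) [0..<Suc n]))
    = vertex_sum f [] (fst (hd xs)) (tl xs)"
proof -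
  have diff: "map (\<lambda>i. if i < n then fst (xs ! i) - fst (xs ! Suc i) else fst (xs ! n)) [0..<Suc n]
      = map (difference xs) [0..<Suc n]"
    using assms by (intro map_cong) (auto simp: difference_def less_Suc_eq)
  have nth: "map (\<lambda>i. act (map (difference xs) [0..<Suc n] ! i) (z i)) [0..<Suc n]
      = map (\<lambda>i. act (difference xs i) (z i)) [0..<Suc n]" for z
    by (intro map_cong) (auto simp del: upt_Suc simp: nth_upt)
  show ?thesis
    unfolding psi_gen_def gp_cochain_class diff nth
    by (simp only: free_lift_additive vertex_sum_eq_sum[OF invariant assms])
qed

text \<open>The contribution of a symbol to the first tensor factor; it is zero where the projection vanishes.\<close>

definition symbol_value :: "('m, 'g) mcb_symbol \<Rightarrow> 'a"
  where "symbol_value = (\<lambda>(x0, bs). if length bs = n then vertex_sum f [] (fst x0) (map hd bs) else 0)"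

lemma pure_tensor_hom_AA: "(\<lambda>x. pure_tensor A A x a) \<in> hom A AA"
  by (rule AA.pure_tensor_hom) simp

lemma pure_tensor_zero: "pure_tensor A A 0 a = \<one>\<^bsub>AA\<^esub>"
  using hom_one[OF pure_tensor_hom_AA group_A group_AA] by simp

lemma pure_tensor_add: "pure_tensor A A (x + y) a = pure_tensor A A x a \<otimes>\<^bsub>AA\<^esub> pure_tensor A A y a"
  using hom_mult[OF pure_tensor_hom_AA] by simp

lemma pure_tensor_minus: "pure_tensor A A (- x) a = inv\<^bsub>AA\<^esub> pure_tensor A A x a"
  using group_hom.hom_inv[of A AA "\<lambda>x. pure_tensor A A x a" x] pure_tensor_hom_AA group_A group_AA
  by (simp add: group_hom_def group_hom_axioms_def)

lemma Phi_chain_symbol: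
  "\<Phi> (frag_of (x0, bs)) = pure_tensor A A (symbol_value (x0, bs)) (l (snd x0))"
proof (cases "length bs = n")
  case True
  then have "gp_cochain f (psi_gen act \<phi> n (map snd (x0 # map hd bs))
      (map (\<lambda>i. if i < n then fst ((x0 # map hd bs) ! i) - fst ((x0 # map hd bs) ! Suc i)
        else fst ((x0 # map hd bs) ! n)) [0..<Suc n]))
    = vertex_sum f [] (fst x0) (map hd bs)"
    by (subst gp_cochain_psi_gen) simp_all
  then show ?thesis
    using True by (simp add: Phi_chain_def mcb_proj_def gamma_map_def psi_lambda_frag_of
        tensor_id_pure symbol_value_def del: upt_Suc)
next
  case False
  have "\<Phi> (frag_of (x0, bs)) = \<Phi> 0"
    using False by (simp add: Phi_chain_def mcb_proj_def)
  then show ?thesis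
    using False by (simp add: frag_hom_zero[OF group_AA Phi_chain_hom] symbol_value_def pure_tensor_zero)
qed

text \<open>All terms in the boundary of a symbol have the same second factor \<open>\<lambda>(g\<^sub>0)\<close>, because \<open>\<lambda>\<close> is
  invariant under conjugation. Fixing this factor \<open>a\<close> moves the computation from the tensor product to the
  coefficient group, where sums and signs are easier to handle.\<close>

definition represents :: "'a \<Rightarrow> (('m, 'g) mcb_symbol \<Rightarrow>\<^sub>0 int) \<Rightarrow> 'a \<Rightarrow> bool"
  where "represents a c x \<longleftrightarrow> \<Phi> c = pure_tensor A A x a"

lemma represents_symbol: "l (snd x0) = a \<Longrightarrow> represents a (frag_of (x0, bs)) (symbol_value (x0, bs))"
  by (simp add: represents_def Phi_chain_symbol)

lemma represents_add: "represents a c x \<Longrightarrow> represents a d y \<Longrightarrow> represents a (c + d) (x + y)"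
  by (simp add: represents_def frag_hom_add[OF group_AA Phi_chain_hom] pure_tensor_add)

lemma represents_sum: "(\<And>i. i \<in> I \<Longrightarrow> represents a (c i) (x i)) \<Longrightarrow> represents a (sum c I) (sum x I)"
  by (induction I rule: infinite_finite_induct)
    (simp_all add: represents_add, simp_all add: represents_def frag_hom_zero[OF group_AA Phi_chain_hom] pure_tensor_zero)

lemma represents_sign: "represents a c x \<Longrightarrow> represents a (frag_cmul ((- 1) ^ j) c) (signed j x)"
  by (auto simp: represents_def signed_def frag_hom_minus[OF group_AA Phi_chain_hom] pure_tensor_minus)

lemma represents_zero: "represents a c 0 \<Longrightarrow> \<Phi> c = \<one>\<^bsub>AA\<^esub>"
  by (simp add: represents_def pure_tensor_zero)

end

section \<open>Cocycle conditions\<close>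

lemma length_le_sum_list_length:
  "\<forall>b\<in>set bs. b \<noteq> [] \<Longrightarrow> length bs \<le> sum_list (map length bs)"
proof (induction bs)
  case (Cons b bs)
  then show ?case by (cases b) auto
qed simp

text \<open>The equality case of the preceding estimate.\<close>

lemma singleton_blocks:
  assumes "\<forall>b\<in>set bs. b \<noteq> []" "sum_list (map length bs) = length bs"
  shows "\<exists>xs. bs = map (\<lambda>x. [x]) xs"
  using assms
proof (induction bs)
  case (Cons b bs)
  have "length bs \<le> sum_list (map length bs)" "1 \<le> length b"
    using Cons.prems(1) by (simp_all add: length_le_sum_list_length Suc_le_eq)
  moreover have "length b + sum_list (map length bs) = Suc (length bs)"
    using Cons.prems(2) by simp
  ultimately have "length b = 1" "sum_list (map length bs) = length bs"
    by linarith+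
  then obtain x xs where "b = [x]" "bs = map (\<lambda>x. [x]) xs"
    using Cons by (auto simp: length_Suc_conv)
  then have "b # bs = map (\<lambda>x. [x]) (x # xs)" by simp
  then show ?case by (rule exI)
qed simp

context alexander_cocycle
begin

text \<open>The two functions below name the symbols occurring in the boundary formula, the first for the term
  with the biquandle operations, the second for the omission of the \<open>j\<close>-th entry of block \<open>i\<close>, with
  \<open>j\<close> counted from 1 as in that formula.\<close>

definition upper_symbol :: "('m, 'g) mcb_symbol \<Rightarrow> nat \<Rightarrow> ('m, 'g) mcb_symbol"
  where "upper_symbol = (\<lambda>(x0, bs) i.
    let b = bs ! i; y = hd b;
        under = (\<lambda>x. under_op act \<phi> x y); over = (\<lambda>x. over_op act \<phi> x y)
    in (under x0, filter (\<lambda>b. b \<noteq> [])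
          (map (map under) (take i bs)
           @ [map (\<lambda>x. over (fibre_mult (fibre_inv y) x)) (tl b)]
           @ map (map over) (drop (Suc i) bs))))"

definition lower_symbol :: "('m, 'g) mcb_symbol \<Rightarrow> nat \<Rightarrow> nat \<Rightarrow> ('m, 'g) mcb_symbol"
  where "lower_symbol = (\<lambda>(x0, bs) i j. (x0, filter (\<lambda>b. b \<noteq> [])
    (take i bs @ [take (j - 1) (bs ! i) @ drop j (bs ! i)] @ drop (Suc i) bs)))"

definition block_value :: "('m, 'g) mcb_symbol \<Rightarrow> nat \<Rightarrow> 'a"
  where "block_value s i = symbol_value (upper_symbol s i)
    + (\<Sum>j = 1..length (snd s ! i). signed j (symbol_value (lower_symbol s i j)))"

lemma boundary_represents:
  "represents (l (snd (fst s))) (mcb_boundary_gen act \<phi> s)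
    (\<Sum>i<length (snd s). signed (sum_list (map length (take i (snd s)))) (block_value s i))"
proof -
  obtain x0 bs where s: "s = (x0, bs)" by (cases s)
  have upper: "represents (l (snd x0)) (frag_of (upper_symbol s i)) (symbol_value (upper_symbol s i))" for i
    unfolding upper_symbol_def s Let_def prod.case
    by (rule represents_symbol) (simp add: under_op_def case_prod_beta lambda_conj)
  have lower: "represents (l (snd x0)) (frag_of (lower_symbol s i j)) (symbol_value (lower_symbol s i j))" for i j
    unfolding lower_symbol_def s prod.case by (rule represents_symbol) simp
  have "mcb_boundary_gen act \<phi> s = (\<Sum>i<length bs. frag_cmul ((- 1) ^ sum_list (map length (take i bs)))
      (frag_of (upper_symbol s i) + (\<Sum>j = 1..length (bs ! i). frag_cmul ((- 1) ^ j) (frag_of (lower_symbol s i j)))))"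
    by (simp add: s mcb_boundary_gen_def upper_symbol_def lower_symbol_def Let_def)
  then show ?thesis
    unfolding block_value_def
    by (simp only: s fst_conv snd_conv)
      (intro represents_sum represents_sign represents_add upper[unfolded s] lower[unfolded s])
qed

lemma block_value_singletons:
  fixes xs :: "('m \<times> 'g) list"
  assumes "length xs = Suc n" "i < length xs"
  shows "block_value (x0, map (\<lambda>x. [x]) xs) i
    = upper_face f [] (fst x0) (take i xs) (xs ! i) (drop (Suc i) xs)
      - vertex_sum f [] (fst x0) (take i xs @ drop (Suc i) xs)"
proof -
  have len: "length (take i xs) + length (drop (Suc i) xs) = n" using assms by simp
  have [simp]: "filter (\<lambda>b. b \<noteq> []) (map (\<lambda>x. [h x]) ys) = map (\<lambda>x. [h x]) ys"
    for h :: "'m \<times> 'g \<Rightarrow> 'm \<times> 'g" and ys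
    by (simp add: filter_map comp_def)
  show ?thesis
    using assms len upper_face_eq[OF invariant, of "take i xs" "drop (Suc i) xs" x0 "xs ! i"]
    by (simp add: block_value_def upper_symbol_def lower_symbol_def symbol_value_def Let_def
        take_map drop_map comp_def)
qed

text \<open>Removing an entry from a block of length one leaves fewer than \<open>n\<close> blocks, and from any other block it
  leaves the number of blocks unchanged. So there is something to show only for a symbol with exactly \<open>n\<close>
  blocks and a block of length at least two, whose length is then two; its three terms cancel by
  \<open>vertex_sum_split\<close>.\<close>

lemma block_value_nonsingletons:
  assumes s: "(x0, bs) \<in> mcb_symbols (Suc n)" and k: "length bs \<le> n" and i: "i < length bs"
  shows "block_value (x0, bs) i = 0"
proof -
  let ?b = "bs ! i" and ?us = "take i bs" and ?vs = "drop (Suc i) bs"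
  have nonempty: "\<forall>b\<in>set bs. b \<noteq> []" and total: "sum_list (map length bs) = Suc n"
    and fibre: "same_fibre ?b"
    using s i by (auto simp: mcb_symbols_def)
  have split: "bs = ?us @ [?b] @ ?vs" using i by (simp add: id_take_nth_drop)
  have ne: "b \<noteq> []" if "b \<in> set ?us \<or> b \<in> set ?vs" for b
    using that nonempty by (auto dest: in_set_takeD in_set_dropD)
  have filter_id: "filter (\<lambda>b. b \<noteq> []) ?us = ?us" "filter (\<lambda>b. b \<noteq> []) ?vs = ?vs"
    "filter (\<lambda>b. b \<noteq> []) (map (map h) ?us) = map (map h) ?us"
    "filter (\<lambda>b. b \<noteq> []) (map (map h) ?vs) = map (map h) ?vs" for h :: "'m \<times> 'g \<Rightarrow> 'm \<times> 'g"
    using ne by (auto simp: filter_id_conv)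
  show ?thesis
  proof (cases "length bs = n \<and> length ?b \<noteq> 1")
    case False
    have "?b \<noteq> []" using nonempty i by simp
    have "length (snd (upper_symbol (x0, bs) i)) \<noteq> n"
      using False k i \<open>?b \<noteq> []\<close> by (cases ?b) (auto simp: upper_symbol_def Let_def filter_id)
    moreover have "length (snd (lower_symbol (x0, bs) i j)) \<noteq> n" if "j \<in> {1..length ?b}" for j
      using False k i that by (auto simp: lower_symbol_def Let_def filter_id)
    ultimately show ?thesis
      by (simp add: block_value_def symbol_value_def case_prod_beta)
  next
    case True
    have total_le: "length ?us + length ?b + length ?vs \<le> Suc n"
    proof -
      have "sum_list (map length bs) = sum_list (map length ?us) + length ?b + sum_list (map length ?vs)"
        by (subst split) (simp del: append_take_drop_id)
      then show ?thesis
        using total length_le_sum_list_length[of ?us] length_le_sum_list_length[of ?vs] ne by force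
    qed
    have "length ?us + length ?vs + 1 = n" "length ?b \<noteq> 0"
      using True i nonempty by simp_all
    then have "length ?b = 2"
      using True total_le by linarith
    then obtain x y where b: "?b = [x, y]" by (auto simp: numeral_2_eq_2 length_Suc_conv)
    then have same: "fst x = fst y" using fibre by (auto simp: same_fibre_def)
    define us vs where "us = map hd ?us" and "vs = map hd ?vs"
    have len: "length us + length vs + 1 = n" using True i by (simp add: us_def vs_def)
    have hd_map: "map (\<lambda>b. hd (map h b)) ?us = map h us" "map (\<lambda>b. hd (map h b)) ?vs = map h vs"
      for h :: "'m \<times> 'g \<Rightarrow> 'm \<times> 'g"
      using ne by (auto simp: us_def vs_def hd_map)
    let ?z = "(fst x, - snd x + snd y)"
    have upper: "symbol_value (upper_symbol (x0, bs) i) = upper_face f [] (fst x0) us x (?z # vs)"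
      using upper_face_eq[OF invariant, of us "?z # vs" x0 x] True i len
      by (simp add: symbol_value_def upper_symbol_def Let_def b filter_id comp_def hd_map
          fibre_mult_def fibre_inv_def)
    have lower1: "symbol_value (lower_symbol (x0, bs) i 1) = vertex_sum f [] (fst x0) (us @ y # vs)"
      and lower2: "symbol_value (lower_symbol (x0, bs) i 2) = vertex_sum f [] (fst x0) (us @ x # vs)"
      using True i by (simp_all add: symbol_value_def lower_symbol_def b filter_id us_def vs_def)
    have "y = (fst x, snd x + (- snd x + snd y))" by (simp add: same add.assoc[symmetric] prod_eq_iff)
    then have "vertex_sum f [] (fst x0) (us @ y # vs)
        = vertex_sum f [] (fst x0) (us @ x # vs) + upper_face f [] (fst x0) us x (?z # vs)"
      using vertex_sum_split[of f "[]" "fst x0" us "fst x" "snd x" "- snd x + snd y" vs] by simp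
    moreover have "{1..2} = {1, 2::nat}" by auto
    ultimately show ?thesis
      using lower1 lower2 by (simp add: block_value_def b upper signed_def numeral_2_eq_2)
  qed
qed

lemma Phi_chain_boundary_symbol:
  assumes "s \<in> mcb_symbols (Suc n)"
  shows "\<Phi> (mcb_boundary_gen act \<phi> s) = \<one>\<^bsub>AA\<^esub>"
proof -
  obtain x0 bs where s: "s = (x0, bs)" by (cases s)
  have nonempty: "\<forall>b\<in>set bs. b \<noteq> []" and total: "sum_list (map length bs) = Suc n"
    using assms by (auto simp: s mcb_symbols_def)
  have le: "length bs \<le> Suc n" using length_le_sum_list_length[OF nonempty] total by simp
  have "(\<Sum>i<length bs. signed (sum_list (map length (take i bs))) (block_value s i)) = 0"
  proof (cases "length bs = Suc n")
    case True
    then obtain xs where bs: "bs = map (\<lambda>x. [x]) xs"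
      using singleton_blocks[OF nonempty] total by auto
    have xs: "length xs = Suc n" using True bs by simp
    have "(\<Sum>i<length bs. signed (sum_list (map length (take i bs))) (block_value s i))
        = face_sum f [] (fst x0) xs"
      unfolding face_sum_def using xs
      by (intro sum.cong) (simp_all add: s bs block_value_singletons take_map comp_def sum_list_triv)
    then show ?thesis
      using face_sum_zero[OF multilinear invariant xs] xs by force
  next
    case False
    then show ?thesis
      using block_value_nonsingletons[of x0 bs] assms le by (simp add: s)
  qed
  then show ?thesis
    using boundary_represents[of s] by (intro represents_zero) (simp add: s)
qed

lemma Phi_chain_boundary:
  assumes "c \<in> carrier (mcb_P (Suc n))"
  shows "\<Phi> (mcb_boundary act \<phi> c) = \<one>\<^bsub>AA\<^esub>"
  unfolding mcb_boundary_def
  using assms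
  by (intro frag_hom_one_extend[OF group_AA Phi_chain_hom] Phi_chain_boundary_symbol) (auto simp: mcb_P_def)

lemma mcb_shuffle_keys:
  assumes "a \<noteq> []" "same_fibre a" "c \<in> Poly_Mapping.keys (mcb_shuffle a b)"
  shows "length c = length a + length b \<and> same_fibre c"
proof -
  let ?c = "\<lambda>\<mu>. map (\<lambda>j. let p = card {l \<in> {1..length a}. \<mu> l \<le> j}
      in fibre_mult (entry a p) (entry b (j - p))) [1..<Suc (length a + length b)]"
  obtain m where m: "\<And>x. x \<in> set a \<Longrightarrow> fst x = m" using assms(2) by (auto simp: same_fibre_def)
  have "Poly_Mapping.keys (mcb_shuffle a b) \<subseteq> range ?c"
    unfolding mcb_shuffle_def Let_def
    by (rule order_trans[OF keys_sum]) (auto dest!: subsetD[OF keys_cmul])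
  then obtain \<mu> where c: "c = ?c \<mu>" using assms(3) by auto
  have "fst (entry a p) = m" if "p \<le> length a" for p
    using that assms(1) m by (auto simp: entry_def)
  moreover have "card {l \<in> {1..length a}. \<mu> l \<le> j} \<le> length a" for j
    by (rule order_trans[OF card_mono[of "{1..length a}"]]) auto
  ultimately have "fst x = m" if "x \<in> set c" for x
    using that unfolding c Let_def by (auto simp: fibre_mult_def simp del: upt_Suc)
  moreover have "length c = length a + length b" by (simp add: c del: upt_Suc)
  ultimately show ?thesis by (auto simp: same_fibre_def)
qed

text \<open>The relations must be chains of degree \<open>n\<close> for the quotient to be a group; this needs that shuffling
  preserves the total length and the fibre.\<close>

lemma mcb_D_presented:
  "presented_group (mcb_symbols n)
    {frag_of (x0, us @ [a, b] @ vs)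
       - frag_extend (\<lambda>c. frag_of (x0, us @ [c] @ vs)) (mcb_shuffle a b) | x0 us a b vs.
       (x0, us @ [a, b] @ vs) \<in> (mcb_symbols n :: ('m, 'g) mcb_symbol set) \<and> same_fibre (a @ b)}"
proof
  have "Poly_Mapping.keys (frag_of (x0, us @ [a, b] @ vs)
       - frag_extend (\<lambda>c. frag_of (x0, us @ [c] @ vs)) (mcb_shuffle a b)) \<subseteq> mcb_symbols n"
    if s: "(x0, us @ [a, b] @ vs) \<in> (mcb_symbols n :: ('m, 'g) mcb_symbol set)" and fibre: "same_fibre (a @ b)"
    for x0 us a b vs
  proof -
    have a: "a \<noteq> []" "same_fibre a" using s by (simp_all add: mcb_symbols_def)
    have "(x0, us @ [c] @ vs) \<in> mcb_symbols n" if "c \<in> Poly_Mapping.keys (mcb_shuffle a b)" for c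
      using mcb_shuffle_keys[OF a that] a s by (auto simp: mcb_symbols_def)
    then have "Poly_Mapping.keys (frag_extend (\<lambda>c. frag_of (x0, us @ [c] @ vs)) (mcb_shuffle a b)) \<subseteq> mcb_symbols n"
      using keys_frag_extend[of "\<lambda>c. frag_of (x0, us @ [c] @ vs)" "mcb_shuffle a b"] by fastforce
    then show ?thesis
      using s by (intro order_trans[OF keys_diff]) auto
  qed
  then show "{frag_of (x0, us @ [a, b] @ vs)
       - frag_extend (\<lambda>c. frag_of (x0, us @ [c] @ vs)) (mcb_shuffle a b) | x0 us a b vs.
       (x0, us @ [a, b] @ vs) \<in> (mcb_symbols n :: ('m, 'g) mcb_symbol set) \<and> same_fibre (a @ b)}
      \<subseteq> carrier (free_Abelian_group (mcb_symbols n))"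
    by (intro subsetI, elim CollectE exE conjE) (simp only: carrier_free_Abelian_group_iff)
qed

text \<open>A shuffle replaces two blocks by one and so leaves fewer than \<open>n\<close> blocks, where the projection
  vanishes. The symbol itself contributes only if all its blocks have length one, and then two
  neighbours have equal module parts.\<close>

lemma Phi_chain_kills_degenerate:
  assumes "r \<in> {frag_of (x0, us @ [a, b] @ vs)
       - frag_extend (\<lambda>c. frag_of (x0, us @ [c] @ vs)) (mcb_shuffle a b) | x0 us a b vs.
       (x0, us @ [a, b] @ vs) \<in> mcb_symbols n \<and> same_fibre (a @ b)}"
  shows "\<Phi> r = \<one>\<^bsub>AA\<^esub>"
proof -
  interpret AA': group AA by (rule group_AA)
  obtain x0 us a b vs where r: "r = frag_of (x0, us @ [a, b] @ vs)
       - frag_extend (\<lambda>c. frag_of (x0, us @ [c] @ vs)) (mcb_shuffle a b)"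
    and s: "(x0, us @ [a, b] @ vs) \<in> mcb_symbols n" and fibre: "same_fibre (a @ b)"
    using assms by blast
  have "length (us @ [a, b] @ vs) \<le> n"
    using s length_le_sum_list_length[of "us @ [a, b] @ vs"] by (simp add: mcb_symbols_def)
  then have "symbol_value (x0, us @ [c] @ vs) = 0" for c
    by (simp add: symbol_value_def)
  then have "\<Phi> (frag_extend (\<lambda>c. frag_of (x0, us @ [c] @ vs)) (mcb_shuffle a b)) = \<one>\<^bsub>AA\<^esub>"
    by (intro frag_hom_one_extend[OF group_AA Phi_chain_hom]) (simp add: Phi_chain_symbol pure_tensor_zero)
  moreover have "symbol_value (x0, us @ [a, b] @ vs) = 0"
  proof -
    have "a \<noteq> []" "b \<noteq> []" using s by (simp_all add: mcb_symbols_def)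
    then have "fst (hd a) = fst (hd b)" using fibre by (auto simp: same_fibre_def)
    then show ?thesis
      using vertex_sum_degenerate[OF multilinear, of "[]" "map hd us" "map hd vs" "hd a" "hd b"]
      by (simp add: symbol_value_def)
  qed
  ultimately show ?thesis
    by (simp add: r frag_hom_diff[OF group_AA Phi_chain_hom] Phi_chain_symbol pure_tensor_zero)
qed

lemma Phi_class: "Phi act \<phi> l n f (mcb_class n c) = \<Phi> c"
  using presented_group.quotient_lift_coset[OF mcb_D_presented group_AA Phi_chain_hom Phi_chain_kills_degenerate]
  by (simp add: Phi_def mcb_class_def mcb_D_def mcb_P_def)

lemma Phi_hom: "Phi act \<phi> l n f \<in> hom (mcb_C n) AA"
  using presented_group.quotient_lift_hom[OF mcb_D_presented group_AA Phi_chain_hom Phi_chain_kills_degenerate]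
  by (simp add: Phi_def mcb_C_def mcb_D_def mcb_P_def)

lemma Phi_cocycle: "mcb_cocycle act \<phi> AA n (Phi act \<phi> l n f)"
  by (simp add: mcb_cocycle_def Phi_hom Phi_class Phi_chain_boundary)

lemma pure_tensor_diff:
  "pure_tensor A A (x - y) a = pure_tensor A A x a \<otimes>\<^bsub>AA\<^esub> inv\<^bsub>AA\<^esub> pure_tensor A A y a"
  using pure_tensor_add[of x "- y" a] by (simp add: pure_tensor_minus)

lemma Phi_singletons:
  assumes "length xs = n"
  shows "Phi act \<phi> l n f (mcb_class n (frag_of (x0, map (\<lambda>x. [x]) xs)))
    = pure_tensor A A (vertex_sum f [] (fst x0) xs) (l (snd x0))"
  using assms by (simp add: Phi_class Phi_chain_symbol symbol_value_def comp_def)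

end

lemma mcb_cocycle_compose:
  assumes "mcb_cocycle act \<phi> B n F" "\<theta> \<in> hom B B'" "group B" "group B'"
  shows "mcb_cocycle act \<phi> B' n (\<theta> \<circ> F)"
  using assms hom_one[OF assms(2-4)] by (auto simp: mcb_cocycle_def intro: hom_compose)

theorem theorem6p11:
  fixes act :: "'m::ab_group_add \<Rightarrow> ('g::group_add \<Rightarrow>\<^sub>0 int) \<Rightarrow> 'm"  (infixl \<open>\<cdot>\<close> 75)
    and \<phi> :: "'g \<Rightarrow> 'g"
    and l :: "'g \<Rightarrow> 'a::ab_group_add"
    and \<theta> :: "('a \<times> 'a \<Rightarrow>\<^sub>0 int) set \<Rightarrow> 'a"
  defines "A \<equiv> additive_group :: 'a monoid"
  defines "AA \<equiv> tensor_group A A"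
  assumes module: "right_module act"
    and phi_hom: "\<And>g h. \<phi> (g + h) = \<phi> g + \<phi> h"
    and phi_central: "\<And>g h. \<phi> g + h = h + \<phi> g"
    and lambda_hom: "\<And>g h. l (g + h) = l g + l h"
    and identification: "\<theta> \<in> hom AA A"
  shows
    "(\<forall>f :: 'm list \<Rightarrow> 'a. multilinear 3 f \<and> G_invariant act 3 f \<longrightarrow>
       (\<forall>c\<in>carrier (mcb_P 2). Phi act \<phi> l 2 f (mcb_class 2 c) = Phi_chain act \<phi> l 2 f c) \<and>
       mcb_cocycle act \<phi> AA 2 (Phi act \<phi> l 2 f) \<and>
       mcb_cocycle act \<phi> A 2 (\<theta> \<circ> Phi act \<phi> l 2 f) \<and>
       (\<forall>m0 g0 m1 g1 m2 g2.
          let \<Phi> = Phi act \<phi> l 2 f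
                (mcb_class 2 (frag_of ((m0, g0), [[(m1, g1)], [(m2, g2)]])));
              T = pure_tensor A A
                (f [(m0 - m1) \<cdot> (1 - frag_of (- \<phi> g1 + g1)),
                    m1 - m2,
                    m2 \<cdot> (1 - frag_of (\<phi> g2 + - g2))])
                (l g0)
          in \<Phi> = T \<and> \<theta> \<Phi> = \<theta> T))
     \<and>
     (\<forall>f :: 'm list \<Rightarrow> 'a. multilinear 4 f \<and> G_invariant act 4 f \<longrightarrow>
       (\<forall>c\<in>carrier (mcb_P 3). Phi act \<phi> l 3 f (mcb_class 3 c) = Phi_chain act \<phi> l 3 f c) \<and>
       mcb_cocycle act \<phi> AA 3 (Phi act \<phi> l 3 f) \<and>
       mcb_cocycle act \<phi> A 3 (\<theta> \<circ> Phi act \<phi> l 3 f) \<and>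
       (\<forall>m0 g0 m1 g1 m2 g2 m3 g3.
          let \<Phi> = Phi act \<phi> l 3 f
                (mcb_class 3 (frag_of ((m0, g0), [[(m1, g1)], [(m2, g2)], [(m3, g3)]])));
              T1 = pure_tensor A A
                (f [(m0 - m1) \<cdot> (1 - frag_of (- \<phi> g1 + g1)),
                    m1 - m2,
                    m2 - m3,
                    m3 \<cdot> (1 - frag_of (\<phi> g3 + - g3))])
                (l g0);
              T2 = pure_tensor A A
                (f [(m0 - m1) \<cdot> (1 - frag_of (- \<phi> g1 + g1)) \<cdot> frag_of g2,
                    (m1 - m2) \<cdot> frag_of g2,
                    (m2 - m3) \<cdot> frag_of (\<phi> g2),
                    m3 \<cdot> (1 - frag_of (\<phi> g3 + - g3)) \<cdot> frag_of (\<phi> g2)])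
                (l g0)
          in \<Phi> = T1 \<otimes>\<^bsub>AA\<^esub> inv\<^bsub>AA\<^esub> T2 \<and> \<theta> \<Phi> = \<theta> T1 - \<theta> T2))"
proof -
  interpret mcb: alexander_mcb act \<phi>
    by (intro alexander_mcb.intro alexander_mcb_axioms.intro module phi_hom phi_central)
  have cocycle_data: "alexander_cocycle act \<phi> l n f"
    if "multilinear (Suc n) f" "G_invariant act (Suc n) f" for n and f :: "'m list \<Rightarrow> 'a"
    by (intro alexander_cocycle.intro alexander_cocycle_axioms.intro mcb.alexander_mcb_axioms lambda_hom that)
  have groups: "group A" "group AA"
    unfolding AA_def A_def
    by (intro comm_group.axioms(2) comm_group_additive_group tensor_product.comm_group_tensor_group tensor_product.intro)+
  have degree2: "(\<forall>c\<in>carrier (mcb_P 2). Phi act \<phi> l 2 f (mcb_class 2 c) = Phi_chain act \<phi> l 2 f c) \<and>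
       mcb_cocycle act \<phi> AA 2 (Phi act \<phi> l 2 f) \<and>
       mcb_cocycle act \<phi> A 2 (\<theta> \<circ> Phi act \<phi> l 2 f) \<and>
       Phi act \<phi> l 2 f (mcb_class 2 (frag_of ((m0, g0), [[(m1, g1)], [(m2, g2)]])))
         = pure_tensor A A
                (f [(m0 - m1) \<cdot> (1 - frag_of (- \<phi> g1 + g1)),
                    m1 - m2,
                    m2 \<cdot> (1 - frag_of (\<phi> g2 + - g2))])
                (l g0)"
    if f: "multilinear 3 f" "G_invariant act 3 f" for f :: "'m list \<Rightarrow> 'a" and m0 g0 m1 g1 m2 g2
  proof -
    interpret alexander_cocycle act \<phi> l 2 f using cocycle_data[of 2 f] f by simp
    show ?thesis
      using Phi_class Phi_cocycle mcb_cocycle_compose[OF Phi_cocycle identification[unfolded A_def AA_def]] groups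
        Phi_singletons[of "[(m1, g1), (m2, g2)]" "(m0, g0)"]
        mcb.vertex_sum_first[OF f(1), of "[(m2, g2)]" m0 "(m1, g1)"]
        mcb.vertex_sum_last[OF f, of "[(m0 - m1) \<cdot> (1 - frag_of (- \<phi> g1 + g1))]" m1 "(m2, g2)"]
      by (simp add: A_def AA_def mcb.twist_def)
  qed
  have degree3: "(\<forall>c\<in>carrier (mcb_P 3). Phi act \<phi> l 3 f (mcb_class 3 c) = Phi_chain act \<phi> l 3 f c) \<and>
       mcb_cocycle act \<phi> AA 3 (Phi act \<phi> l 3 f) \<and>
       mcb_cocycle act \<phi> A 3 (\<theta> \<circ> Phi act \<phi> l 3 f) \<and>
       Phi act \<phi> l 3 f (mcb_class 3 (frag_of ((m0, g0), [[(m1, g1)], [(m2, g2)], [(m3, g3)]])))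
         = pure_tensor A A
                (f [(m0 - m1) \<cdot> (1 - frag_of (- \<phi> g1 + g1)),
                    m1 - m2,
                    m2 - m3,
                    m3 \<cdot> (1 - frag_of (\<phi> g3 + - g3))])
                (l g0)
           \<otimes>\<^bsub>AA\<^esub> inv\<^bsub>AA\<^esub> pure_tensor A A
                (f [(m0 - m1) \<cdot> (1 - frag_of (- \<phi> g1 + g1)) \<cdot> frag_of g2,
                    (m1 - m2) \<cdot> frag_of g2,
                    (m2 - m3) \<cdot> frag_of (\<phi> g2),
                    m3 \<cdot> (1 - frag_of (\<phi> g3 + - g3)) \<cdot> frag_of (\<phi> g2)])
                (l g0)"
    if f: "multilinear 4 f" "G_invariant act 4 f" for f :: "'m list \<Rightarrow> 'a" and m0 g0 m1 g1 m2 g2 m3 g3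
  proof -
    interpret alexander_cocycle act \<phi> l 3 f using cocycle_data[of 3 f] f by simp
    let ?u = "(m0 - m1) \<cdot> (1 - frag_of (- \<phi> g1 + g1))" and ?w = "m3 \<cdot> (1 - frag_of (\<phi> g3 + - g3))"
    let ?t = "mcb.twist g2"
    have "mcb.vertex_sum f [] m0 [(m1, g1), (m2, g2), (m3, g3)] = mcb.vertex_sum f [?u] m1 [(m2, g2), (m3, g3)]"
      using mcb.vertex_sum_first[OF f(1), of "[(m2, g2), (m3, g3)]" m0 "(m1, g1)"] by (simp add: mcb.twist_def)
    also have "\<dots> = f [?u, m1 - m2, m2 - m3, ?w]
        - f [?u \<cdot> frag_of ?t, (m1 - m2) \<cdot> frag_of ?t, m2 - m3, ?w]"
      using mcb.vertex_sum_last[OF f, of "[?u, m1 - m2]" m2 "(m3, g3)"]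
        mcb.vertex_sum_last[OF f, of "[?u \<cdot> frag_of ?t, (m1 - m2) \<cdot> frag_of ?t]" m2 "(m3, g3)"]
      by (simp add: mcb.vertex_sum_Cons[of _ _ _ "(m2, g2)"])
    \<comment> \<open>A common translation by the central element \<open>\<phi> g2\<close> turns the twist into \<open>g2\<close> itself.\<close>
    also have "f [?u \<cdot> frag_of ?t, (m1 - m2) \<cdot> frag_of ?t, m2 - m3, ?w]
        = f [?u \<cdot> frag_of g2, (m1 - m2) \<cdot> frag_of g2, (m2 - m3) \<cdot> frag_of (\<phi> g2), ?w \<cdot> frag_of (\<phi> g2)]"
      using mcb.G_invariantD[OF f(2), of "[?u \<cdot> frag_of ?t, (m1 - m2) \<cdot> frag_of ?t, m2 - m3, ?w]" "\<phi> g2"]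
      by (simp add: mcb.twist_phi)
    finally show ?thesis
      using Phi_class Phi_cocycle mcb_cocycle_compose[OF Phi_cocycle identification[unfolded A_def AA_def]] groups
        Phi_singletons[of "[(m1, g1), (m2, g2), (m3, g3)]" "(m0, g0)"]
      by (simp add: A_def AA_def pure_tensor_diff)
  qed
  have theta_diff: "\<theta> (pure_tensor A A x a \<otimes>\<^bsub>AA\<^esub> inv\<^bsub>AA\<^esub> pure_tensor A A y a)
      = \<theta> (pure_tensor A A x a) - \<theta> (pure_tensor A A y a)" for x y a
  proof -
    interpret \<theta>: group_hom AA A \<theta>
      using groups identification by (simp add: group_hom_def group_hom_axioms_def)
    have "pure_tensor A A x a \<in> carrier AA" for x
      unfolding AA_def A_def
      by (rule tensor_product.pure_tensor_closed) (simp_all add: tensor_product.intro comm_group_additive_group)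
    then show ?thesis by (simp add: A_def)
  qed
  show ?thesis
    unfolding Let_def using degree2 degree3 by (simp add: theta_diff)
qed

end
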